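(* Let $m$ be a positive integer and $n:=2m+1$. Let $C_{2m+1}:=\bigl|\{1\leq k\leq 2m : S_{k-1}\cdot S_{k+1}<0\}\bigr|$ be the number of sign changes up to time $n$ of the simple symmetric random walk $(S_k)_{k\ge 0}$, and let $W:=2C_{2m+1}/\sqrt{2m+1}$. Let $Y:=|Z|$, where $Z$ is a standard normal random variable. Then $$d_{\mathcal{W}}(W,Y)\leq\frac{1}{\sqrt{n}}\Bigl(4+\frac{2}{\pi}\Bigr)+\sqrt{\frac{2}{\pi}}\,\frac{1}{n}+\frac{2\sqrt{2}}{\pi}\,\frac{1}{n^{3/2}}$$ and $$d_{\mathcal{K}}(W,Y)\leq\frac{1}{\sqrt{n}}\Bigl(\frac{2\sqrt{2}+4}{\sqrt{\pi}}+\frac{3}{2}\Bigr)+\frac{3}{n}+\frac{4}{\sqrt{\pi}}\,\frac{1}{n^{3/2}}.$$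
   Context: The simple symmetric random walk is $S_0:=0$, $S_k:=\sum_{j=1}^k X_j$ for $k\geq 1$, where $X_1,X_2,\dots$ are i.i.d. with $P(X_1=1)=P(X_1=-1)=1/2$. For real random variables $U,V$ with finite first moments, the Wasserstein distance is $d_{\mathcal{W}}(U,V):=\sup_{h}|E[h(U)]-E[h(V)]|$, where the supremum is over all functions $h:\mathbb{R}\to\mathbb{R}$ that are Lipschitz continuous with Lipschitz constant at most $1$. The Kolmogorov distance is $d_{\mathcal{K}}(U,V):=\sup_{z\in\mathbb{R}}|P(U\leq z)-P(V\leq z)|$. Both depend only on the distributions of $U$ and $V$. *)

theory Defs
  imports "HOL-Probability.Probability"
begin

text \<open>The two random variables may live on different probability spaces. The suprema are
  taken in \<^typ>\<open>ereal\<close>, where they are meaningful without a boundedness side condition.\<close>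

definition wasserstein_dist ::
    "'a measure \<Rightarrow> ('a \<Rightarrow> real) \<Rightarrow> 'b measure \<Rightarrow> ('b \<Rightarrow> real) \<Rightarrow> ereal" where
  "wasserstein_dist M U N V =
     (SUP h \<in> {h :: real \<Rightarrow> real. 1-lipschitz_on UNIV h}.
        ereal \<bar>(\<integral>\<omega>. h (U \<omega>) \<partial>M) - (\<integral>\<omega>. h (V \<omega>) \<partial>N)\<bar>)"

definition kolmogorov_dist ::
    "'a measure \<Rightarrow> ('a \<Rightarrow> real) \<Rightarrow> 'b measure \<Rightarrow> ('b \<Rightarrow> real) \<Rightarrow> ereal" where
  "kolmogorov_dist M U N V =
     (SUP z :: real. ereal \<bar>measure M {\<omega> \<in> space M. U \<omega> \<le> z} - measure N {\<omega> \<in> space N. V \<omega> \<le> z}\<bar>)"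

text \<open>The steps are indexed from 1; \<open>X 0\<close> is never used.\<close>

definition simple_symmetric_steps :: "'a measure \<Rightarrow> (nat \<Rightarrow> 'a \<Rightarrow> real) \<Rightarrow> bool" where
  "simple_symmetric_steps M X \<longleftrightarrow>
     prob_space M \<and>
     prob_space.indep_vars M (\<lambda>_. borel) X {1..} \<and>
     (\<forall>j\<ge>1. distr M borel (X j) = distr M borel (X 1)) \<and>
     measure M {\<omega> \<in> space M. X 1 \<omega> = 1} = 1 / 2 \<and>
     measure M {\<omega> \<in> space M. X 1 \<omega> = -1} = 1 / 2"

definition walk :: "(nat \<Rightarrow> 'a \<Rightarrow> real) \<Rightarrow> nat \<Rightarrow> 'a \<Rightarrow> real" where
  "walk X k \<omega> = (\<Sum>j = 1..k. X j \<omega>)"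

text \<open>Sign changes up to time \<open>n\<close>; a sign change at \<open>k\<close> refers to the position at \<open>k + 1 \<le> n\<close>,
  so for \<open>n = 2 * m + 1\<close> the index \<open>k\<close> ranges over \<open>1, \<dots>, 2 * m\<close>.\<close>

definition sign_changes :: "(nat \<Rightarrow> 'a \<Rightarrow> real) \<Rightarrow> nat \<Rightarrow> 'a \<Rightarrow> nat" where
  "sign_changes X n \<omega> = card {k \<in> {1..<n}. walk X (k - 1) \<omega> * walk X (k + 1) \<omega> < 0}"

end

theory Submission
  imports Defs "HOL-Real_Asymp.Real_Asymp"
begin

text \<open>At odd times \<open>2 * j + 1\<close> the number \<open>C\<close> of sign changes and the distance from 0 form a Markov chain that
solves a reflection problem: the half distance is a lazy walk kept nonnegative by pushes at 0, and each push
is a sign change. Hence the reflection principle gives the joint law explicitly (\<open>joint_count\<close>), and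
summing out the distance gives \<open>P (C = c) = (2 * m + 1 choose m + 1 + c) / 4 ^ m\<close>
(\<open>sign_changes_distribution\<close>); in other words, \<open>2 * C + 1\<close> is distributed like the distance from 0 at time
\<open>n = 2 * m + 1\<close>.

The ratio of consecutive probabilities yields, for \<open>g 0 = 0\<close>, the identity
\<open>E (n * (g (C + 1) - g C)) = E ((2 * C + 1) * (g (C + 1) + g C))\<close> (\<open>discrete_stein_identity\<close>), a discrete
counterpart of \<open>E (f' Y) = E (Y * f Y)\<close> for the half-normal variable \<open>Y\<close> and \<open>f 0 = 0\<close>. Let \<open>d = 2 / sqrt n\<close>, so that
\<open>W = d * C\<close>, and let \<open>f\<close> be the solution of \<open>f' x = x * f x + h x - E (h Y)\<close> with \<open>f 0 = 0\<close>. For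
\<open>g c = f (d * c)\<close> the identity says that the mean of \<open>h\<close> over the random cell \<open>[W, W + d]\<close> differs from
\<open>E (h Y)\<close> only by the error of a trapezoidal approximation of \<open>x * f x\<close>. This error is
\<open>d + d\<^sup>2 / 2\<close> at most (\<open>smoothed_expectation_bound\<close>), because \<open>\<bar>f'\<bar> \<le> 2\<close> both for 1-Lipschitz \<open>h\<close> and for
\<open>h\<close> with values in \<open>[0, 1]\<close> (\<open>stein_deriv_bound_lipschitz\<close>, \<open>stein_deriv_bound_bounded\<close>), and because the
mean of \<open>W + d / 2\<close> is at most 1.

For the Wasserstein distance, replacing the cell mean by the value at \<open>W\<close> costs another \<open>d / 2\<close>. For the
Kolmogorov distance, indicators are sandwiched between ramps of width \<open>d\<close>, which costs at most the
half-normal probability of an interval of length \<open>2 * d\<close>. Both totals lie below the stated constants.\<close>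

section \<open>Counting paths by sign changes and position\<close>

text \<open>Paths are extensional functions on the times \<open>1, \<dots>, n\<close>, so that there are exactly \<open>2 ^ n\<close> of them.\<close>
definition sign_paths :: "nat \<Rightarrow> (nat \<Rightarrow> real) set" where
  "sign_paths n = PiE {1..n} (\<lambda>_. {1, -1})"

text \<open>Both notions are the ones for random walks, read on the space of all step sequences with the
coordinate maps as steps. This makes the number of sign changes of a random walk a function of
its step sequence.\<close>
abbreviation path_walk :: "(nat \<Rightarrow> real) \<Rightarrow> nat \<Rightarrow> real" where
  "path_walk x n \<equiv> walk (\<lambda>i y. y i) n x"

abbreviation path_changes :: "(nat \<Rightarrow> real) \<Rightarrow> nat \<Rightarrow> nat" where
  "path_changes x n \<equiv> sign_changes (\<lambda>i y. y i) n x"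

lemma finite_sign_paths [simp]: "finite (sign_paths n)"
  unfolding sign_paths_def by (intro finite_PiE) auto

lemma card_sign_paths_Suc:
  "card {x \<in> sign_paths (Suc n). Q x} =
     (\<Sum>s\<in>{1, -1}. card {x \<in> sign_paths n. Q (x(Suc n := s))})"
proof -
  have dom: "{1..Suc n} = insert (Suc n) {1..n}" by auto
  have eq: "{x \<in> sign_paths (Suc n). Q x} =
      (\<Union>s\<in>{1, -1}. (\<lambda>x. x(Suc n := s)) ` {x \<in> sign_paths n. Q (x(Suc n := s))})"
    unfolding sign_paths_def dom PiE_insert_eq by auto
  have inj: "inj_on (\<lambda>x. x(Suc n := s)) {x \<in> sign_paths n. Q (x(Suc n := s))}" for s
  proof (rule inj_onI)
    fix x y assume "x \<in> {x \<in> sign_paths n. Q (x(Suc n := s))}"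
      and "y \<in> {x \<in> sign_paths n. Q (x(Suc n := s))}" and e: "x(Suc n := s) = y(Suc n := s)"
    then have "x \<in> sign_paths n" "y \<in> sign_paths n" by auto
    then have "x (Suc n) = y (Suc n)"
      using PiE_arb [of x "{1..n}" "\<lambda>_. {1, -1}" "Suc n"]
        PiE_arb [of y "{1..n}" "\<lambda>_. {1, -1}" "Suc n"] by (simp add: sign_paths_def)
    with e show "x = y" by (metis fun_upd_idem fun_upd_upd)
  qed
  have ne: "x(Suc n := i) \<noteq> y(Suc n := j)" if "i \<noteq> j" for x y :: "nat \<Rightarrow> real" and i j
    using that by (metis fun_upd_same)
  have "card {x \<in> sign_paths (Suc n). Q x} =
      (\<Sum>s\<in>{1, -1}. card ((\<lambda>x. x(Suc n := s)) ` {x \<in> sign_paths n. Q (x(Suc n := s))}))"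
    unfolding eq
  proof (rule card_UN_disjoint)
    show "\<forall>i\<in>{1, - 1}. \<forall>j\<in>{1, - 1}. i \<noteq> j \<longrightarrow>
      (\<lambda>x. x(Suc n := i)) ` {x \<in> sign_paths n. Q (x(Suc n := i))} \<inter>
      (\<lambda>x. x(Suc n := j)) ` {x \<in> sign_paths n. Q (x(Suc n := j))} = {}"
      by (auto simp: disjoint_iff ne)
  qed auto
  then show ?thesis by (simp add: card_image [OF inj])
qed

lemma card_sign_paths_0: "card (sign_paths 0) = 1"
  by (simp add: sign_paths_def)

lemma path_walk_Suc: "path_walk x (Suc n) = path_walk x n + x (Suc n)"
  by (simp add: walk_def)

lemma path_walk_cong:
  assumes "\<And>i. i \<in> {1..n} \<Longrightarrow> x i = y i"
  shows "path_walk x n = path_walk y n"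
  unfolding walk_def by (rule sum.cong) (use assms in auto)

lemma path_changes_cong:
  assumes "\<And>i. i \<in> {1..n} \<Longrightarrow> x i = y i"
  shows "path_changes x n = path_changes y n"
proof -
  have "path_walk x k = path_walk y k" if "k \<le> n" for k
    using that assms by (intro path_walk_cong) auto
  then have "{k \<in> {1..<n}. path_walk x (k - 1) * path_walk x (k + 1) < 0} =
    {k \<in> {1..<n}. path_walk y (k - 1) * path_walk y (k + 1) < 0}" by auto
  then show ?thesis by (simp add: sign_changes_def)
qed

lemma path_changes_Suc:
  assumes "n \<ge> 1"
  shows "path_changes x (Suc n) =
    path_changes x n + (if path_walk x (n - 1) * path_walk x (Suc n) < 0 then 1 else 0)"
proof -
  have "{k \<in> {1..<Suc n}. path_walk x (k - 1) * path_walk x (k + 1) < 0} =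
    {k \<in> {1..<n}. path_walk x (k - 1) * path_walk x (k + 1) < 0} \<union>
    (if path_walk x (n - 1) * path_walk x (Suc n) < 0 then {n} else {})"
    using assms by (auto simp: less_Suc_eq)
  then show ?thesis by (auto simp: sign_changes_def card_insert_if)
qed

lemma path_walk_odd_time:
  assumes "\<And>i. i \<in> {1..2 * j + 1} \<Longrightarrow> x i \<in> {1, -1}"
  obtains d where "d \<le> j"
    "path_walk x (2 * j + 1) = 2 * real d + 1 \<or> path_walk x (2 * j + 1) = - (2 * real d + 1)"
proof -
  have "\<exists>d\<le>j. path_walk x (2 * j + 1) = 2 * real d + 1 \<or> path_walk x (2 * j + 1) = - (2 * real d + 1)"
    using assms
  proof (induction j)
    case 0
    then show ?case by (force simp: walk_def)
  next
    case (Suc j)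
    then obtain d where d: "d \<le> j"
      "path_walk x (2 * j + 1) = 2 * real d + 1 \<or> path_walk x (2 * j + 1) = - (2 * real d + 1)"
      by force
    have w: "path_walk x (2 * Suc j + 1) = path_walk x (2 * j + 1) + x (2 * j + 2) + x (2 * j + 3)"
      by (simp add: path_walk_Suc numeral_3_eq_3)
    have "x (2 * j + 2) \<in> {1, -1}" "x (2 * j + 3) \<in> {1, -1}"
      using Suc.prems by auto
    then consider "x (2 * j + 2) + x (2 * j + 3) = 0" | "x (2 * j + 2) + x (2 * j + 3) = 2"
      | "x (2 * j + 2) + x (2 * j + 3) = -2" by fastforce
    then show ?case
    proof cases
      case 1
      then show ?thesis using d w by (intro exI [of _ d]) auto
    next
      case 2
      show ?thesis
      proof (cases "path_walk x (2 * j + 1) = 2 * real d + 1")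
        case True
        then show ?thesis using 2 d w by (intro exI [of _ "Suc d"]) auto
      next
        case False
        then show ?thesis using 2 d w
          by (cases d) (auto intro: exI [of _ "d - 1"] exI [of _ 0])
      qed
    next
      case 3
      show ?thesis
      proof (cases "path_walk x (2 * j + 1) = 2 * real d + 1")
        case False
        then show ?thesis using 3 d w by (intro exI [of _ "Suc d"]) auto
      next
        case True
        then show ?thesis using 3 d w
          by (cases d) (auto intro: exI [of _ "d - 1"] exI [of _ 0])
      qed
    qed
  qed
  then show ?thesis using that by blast
qed

text \<open>A sign change can happen only at an even time, because the walk has to be at 0. So going from one
odd time to the next creates at most one sign change, and it can be read off from the two positions
at these odd times: between \<open>2 j\<close> and \<open>2 j + 2\<close> nothing changes sign, as the position in between is a
nonzero integer and so its two neighbours do not lie on opposite sides of 0.\<close>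
lemma path_changes_two_steps:
  assumes "\<And>i. i \<in> {1..2 * j + 3} \<Longrightarrow> x i \<in> {1, -1}"
  shows "path_changes x (2 * j + 3) = path_changes x (2 * j + 1) +
    (if path_walk x (2 * j + 1) * path_walk x (2 * j + 3) < 0 then 1 else 0)"
proof -
  have "\<And>i. i \<in> {1..2 * j + 1} \<Longrightarrow> x i \<in> {1, -1}" using assms by auto
  then obtain d where d:
    "path_walk x (2 * j + 1) = 2 * real d + 1 \<or> path_walk x (2 * j + 1) = - (2 * real d + 1)"
    using path_walk_odd_time by blast
  have w: "path_walk x (2 * j + 1) = path_walk x (2 * j) + x (2 * j + 1)"
    "path_walk x (2 * j + 2) = path_walk x (2 * j + 1) + x (2 * j + 2)"
    by (simp_all add: path_walk_Suc)
  have x: "x (2 * j + 1) \<in> {1, -1}" "x (2 * j + 2) \<in> {1, -1}" using assms by auto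
  have "0 \<le> path_walk x (2 * j) * path_walk x (2 * j + 2)"
  proof (cases "path_walk x (2 * j + 1) = 2 * real d + 1")
    case True
    then have "0 \<le> path_walk x (2 * j)" "0 \<le> path_walk x (2 * j + 2)" using w x by auto
    then show ?thesis by simp
  next
    case False
    then have "path_walk x (2 * j) \<le> 0" "path_walk x (2 * j + 2) \<le> 0" using w x d by auto
    then show ?thesis by (simp add: mult_nonpos_nonpos)
  qed
  then have "path_changes x (2 * j + 2) = path_changes x (2 * j + 1)"
    using path_changes_Suc [of "2 * j + 1" x] by simp
  then show ?thesis
    using path_changes_Suc [of "2 * j + 2" x] by (simp add: numeral_3_eq_3)
qed

text \<open>The pair of sign changes and position, observed at odd times, is a Markov chain. Here \<open>a\<close> is the
last step and \<open>b\<close> the one before it.\<close>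
lemma joint_count_two_steps:
  "card {x \<in> sign_paths (2 * j + 3). path_changes x (2 * j + 3) = c \<and> path_walk x (2 * j + 3) = s} =
   (\<Sum>a\<in>{1, -1}. \<Sum>b\<in>{1, -1}. card {x \<in> sign_paths (2 * j + 1).
      path_changes x (2 * j + 1) + (if (s - a - b) * s < 0 then 1 else 0) = c \<and>
      path_walk x (2 * j + 1) = s - a - b})"
proof -
  have eq: "path_changes (x(2*j+2 := b, 2*j+3 := a)) (2 * j + 3) = c \<and>
        path_walk (x(2*j+2 := b, 2*j+3 := a)) (2 * j + 3) = s \<longleftrightarrow>
      path_changes x (2 * j + 1) + (if (s - a - b) * s < 0 then 1 else 0) = c \<and>
      path_walk x (2 * j + 1) = s - a - b"
    if x: "x \<in> sign_paths (2 * j + 1)" and ab: "a \<in> {1,-1}" "b \<in> {1,-1}" for x a b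
  proof -
    let ?y = "x(2*j+2 := b, 2*j+3 := a)"
    have y: "?y i \<in> {1, -1}" if "i \<in> {1..2 * j + 3}" for i
    proof (cases "i \<le> 2 * j + 1")
      case True
      then have "x i \<in> {1,-1}" using that
      PiE_mem [OF x [unfolded sign_paths_def], of i] by auto
      then show ?thesis using True by auto
    next
      case False
      then have "i = 2*j+2 \<or> i = 2*j+3" using that by auto
      then show ?thesis using ab by auto
    qed
    have w1: "path_walk ?y (2 * j + 1) = path_walk x (2 * j + 1)"
      by (rule path_walk_cong) auto
    have c1: "path_changes ?y (2 * j + 1) = path_changes x (2 * j + 1)"
      by (rule path_changes_cong) auto
    have w3: "path_walk ?y (2 * j + 3) = path_walk x (2 * j + 1) + b + a"
      using w1 by (simp add: path_walk_Suc numeral_3_eq_3 )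
    have c3: "path_changes ?y (2 * j + 3) = path_changes x (2 * j + 1) +
      (if path_walk x (2 * j + 1) * (path_walk x (2 * j + 1) + b + a) < 0 then 1 else 0)"
      using path_changes_two_steps [of j ?y, OF y] unfolding w1 c1 w3 .
    show ?thesis
      unfolding c3 w3 by auto
  qed
  have n: "2 * j + 3 = Suc (Suc (2 * j + 1))" "2 * j + 2 = Suc (2 * j + 1)" by simp_all
  have "card {x \<in> sign_paths (2 * j + 3). Q x} = (\<Sum>a\<in>{1, -1}. \<Sum>b\<in>{1, -1}.
      card {x \<in> sign_paths (2 * j + 1). Q (x(2*j+2 := b, 2*j+3 := a))})" for Q
    unfolding n card_sign_paths_Suc ..
  also have "(\<Sum>a\<in>{1, -1}. \<Sum>b\<in>{1, -1}.
      card {x \<in> sign_paths (2 * j + 1).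
         path_changes (x(2*j+2 := b, 2*j+3 := a)) (2 * j + 3) = c \<and>
        path_walk (x(2*j+2 := b, 2*j+3 := a)) (2 * j + 3) = s}) =
    (\<Sum>a\<in>{1, -1}. \<Sum>b\<in>{1, -1}. card {x \<in> sign_paths (2 * j + 1).
      path_changes x (2 * j + 1) + (if (s - a - b) * s < 0 then 1 else 0) = c \<and>
      path_walk x (2 * j + 1) = s - a - b})"
  proof (intro sum.cong refl)
    fix a b :: real assume ab: "a \<in> {1, -1}" "b \<in> {1, -1}"
    show "card {x \<in> sign_paths (2 * j + 1).
         path_changes (x(2*j+2 := b, 2*j+3 := a)) (2 * j + 3) = c \<and>
         path_walk (x(2*j+2 := b, 2*j+3 := a)) (2 * j + 3) = s} =
      card {x \<in> sign_paths (2 * j + 1).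
        path_changes x (2 * j + 1) + (if (s - a - b) * s < 0 then 1 else 0) = c \<and>
        path_walk x (2 * j + 1) = s - a - b}"
      by (rule arg_cong [where f = card], rule Collect_cong, rule conj_cong [OF refl],
          rule eq [OF _ ab])
  qed
  finally show ?thesis .
qed

lemma binomial_centre_step:
  assumes "k \<ge> 1"
  shows "(2 * j + 2) choose (j + 1 + k) =
    (2 * j choose (j + k - 1)) + 2 * (2 * j choose (j + k)) + (2 * j choose (j + k + 1))"
proof -
  obtain i where i: "j + k = Suc i" using assms by (cases "j + k") auto
  have e: "j + 1 + k = Suc (Suc i)" "j + k - 1 = i" "j + k + 1 = Suc (Suc i)" "2 * j + 2 = Suc (Suc (2 * j))" using i by simp_all
  show ?thesis unfolding i e binomial_Suc_Suc by simp
qed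

text \<open>With \<open>q j k = 2 * j choose (j + k)\<close>, which counts the paths of a simple walk that are at \<open>2 * k\<close> at
time \<open>2 * j\<close>, this is \<open>q j k - q j (k + 2)\<close>. Such differences are what the reflection principle yields
for the number of paths with a prescribed maximum and end point.\<close>
definition joint_weight :: "nat \<Rightarrow> nat \<Rightarrow> int" where
  "joint_weight j k = int (2 * j choose (j + k)) - int (2 * j choose (j + k + 2))"

lemma joint_weight_Suc:
  "joint_weight (Suc j) (Suc k) =
     joint_weight j k + 2 * joint_weight j (Suc k) + joint_weight j (Suc (Suc k))"
  using binomial_centre_step [of "Suc k" j] binomial_centre_step [of "Suc k + 2" j]
  by (simp add: joint_weight_def numeral_eq_Suc)

text \<open>At 0 the two-step recursion loses its term for \<open>k - 1\<close>: by symmetry of the binomial coefficients,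
\<open>q j (-1) = q j 1\<close>, so that term would be 0.\<close>
lemma joint_weight_Suc_0:
  "joint_weight (Suc j) 0 = 2 * joint_weight j 0 + joint_weight j 1"
proof -
  have s: "Suc (2 * j) choose j = Suc (2 * j) choose Suc j"
    using binomial_symmetric [of j "Suc (2 * j)"] by (simp add: Suc_diff_le)
  have "(2 * j + 2) choose (j + 1) = 2 * (2 * j choose j) + 2 * (2 * j choose (j + 1))"
    using s by simp
  then show ?thesis using binomial_centre_step [of 2 j]
    by (simp add: joint_weight_def numeral_eq_Suc)
qed

text \<open>The half distance \<open>d\<close> (where the position is \<open>2 * d + 1\<close> up to sign) is a lazy walk reflected at 0,
and a sign change happens precisely when the walk is pushed back at 0. So the number of sign changes
is the running maximum of a free lazy walk, which ends at \<open>c - d\<close> if its maximum is \<open>c\<close>; reflecting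
the end point in \<open>c\<close> explains why only \<open>c + d\<close> matters. The proof verifies the recursion: a step with a
sign change leads from \<open>(c - 1, 0)\<close> to \<open>(c, 0)\<close>, which has the same effect on \<open>c + d\<close> as the step from
\<open>(c, d - 1)\<close> to \<open>(c, d)\<close> away from the boundary.\<close>
lemma joint_count:
  assumes "\<sigma> \<in> {1, -1}"
  shows "int (card {x \<in> sign_paths (2 * j + 1). path_changes x (2 * j + 1) = c \<and>
     path_walk x (2 * j + 1) = \<sigma> * (2 * real d + 1)}) = joint_weight j (c + d)"
  using assms
proof (induction j arbitrary: c d \<sigma>)
  case 0
  have c: "path_changes x (2 * 0 + 1) = 0" for x by (simp add: sign_changes_def)
  have w: "path_walk x (2 * 0 + 1) = x (Suc 0)" for x by (simp add: walk_def)
  have "{x \<in> sign_paths 0. t = \<sigma> * (2 * real d + 1)}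
      = (if t = \<sigma> * (2 * real d + 1) then {\<lambda>_. undefined} else {})" for t :: real
    by (auto simp: sign_paths_def)
  then have k: "card {x \<in> sign_paths 0. t = \<sigma> * (2 * real d + 1)}
      = (if t = \<sigma> * (2 * real d + 1) then 1 else 0)" for t :: real by simp
  have s: "card {x \<in> sign_paths (2 * 0 + 1). path_changes x (2 * 0 + 1) = c \<and>
     path_walk x (2 * 0 + 1) = \<sigma> * (2 * real d + 1)} = (if c = 0 \<and> d = 0 then 1 else 0)"
    unfolding c w using 0
    by (cases "c = 0"; cases d) (auto simp: card_sign_paths_Suc k card_sign_paths_0)
  have j: "joint_weight 0 k = (if k = 0 then 1 else 0)" for k
    by (cases k) (auto simp: joint_weight_def)
  show ?case unfolding s j by simp
next
  case (Suc j)
  have n: "2 * Suc j + 1 = 2 * j + 3" by simp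
  define D where "D c s = int (card {x \<in> sign_paths (2 * j + 1).
     path_changes x (2 * j + 1) = c \<and> path_walk x (2 * j + 1) = s})" for c s
  have IH: "D c s = joint_weight j (c + d)" 
     if "s = \<sigma> * (2 * real d + 1) \<or> s = - \<sigma> * (2 * real d + 1)" for c d s
    using that
  proof
    assume s: "s = \<sigma> * (2 * real d + 1)"
    show ?thesis unfolding D_def s by (rule Suc.IH [OF Suc.prems])
  next
    assume s: "s = - \<sigma> * (2 * real d + 1)"
    have "- \<sigma> \<in> {1, -1}" using Suc.prems by auto
    then show ?thesis unfolding D_def s by (rule Suc.IH)
  qed
  define T where "T c s t = int (card {x \<in> sign_paths (2 * j + 1).
     path_changes x (2 * j + 1) + (if t * s < 0 then 1 else 0) = c \<and>
      path_walk x (2 * j + 1) = t})" for c s t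
  have T1: "T c s t = D c t" if "\<not> t * s < 0" for c s t
    using that by (simp add: T_def D_def)
  have T2: "T (Suc c) s t = D c t" if "t * s < 0" for c s t
    using that by (simp add: T_def D_def)
  have T3: "T 0 s t = 0" if "t * s < 0" for s t
    using that by (simp add: T_def)
  define s where "s = \<sigma> * (2 * real d + 1)"
  have step: "int (card {x \<in> sign_paths (2 * Suc j + 1). path_changes x (2 * Suc j + 1) = c \<and>
     path_walk x (2 * Suc j + 1) = s}) = T c s (s - 2 * \<sigma>) + 2 * T c s s + T c s (s + 2 * \<sigma>)"
    unfolding n joint_count_two_steps of_nat_sum T_def [symmetric] using Suc.prems by (auto simp: add.commute)
  have \<sigma>: "\<sigma> * \<sigma> = 1" using Suc.prems by auto
  have "s * s = \<sigma> * \<sigma> * ((2 * real d + 1) * (2 * real d + 1))"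
    "(s + 2 * \<sigma>) * s = \<sigma> * \<sigma> * ((2 * real d + 3) * (2 * real d + 1))"
    "(s - 2 * \<sigma>) * s = \<sigma> * \<sigma> * ((2 * real d - 1) * (2 * real d + 1))"
    by (simp_all add: s_def algebra_simps)
  then have s3: "s * s = (2 * real d + 1) * (2 * real d + 1)"
    "(s + 2 * \<sigma>) * s = (2 * real d + 3) * (2 * real d + 1)"
    "(s - 2 * \<sigma>) * s = (2 * real d - 1) * (2 * real d + 1)"
    unfolding \<sigma> by simp_all
  have ss: "\<not> s * s < 0" "\<not> (s + 2 * \<sigma>) * s < 0" unfolding s3 by (simp_all add: not_less)
  have b: "D c s = joint_weight j (c + d)" "D c (s + 2 * \<sigma>) = joint_weight j (c + Suc d)"
    by (rule IH, simp add: s_def algebra_simps)+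
  show ?case
  proof (cases d)
    case (Suc d')
    have "\<not> (s - 2 * \<sigma>) * s < 0" unfolding s3 by (simp add: Suc not_less)
    moreover have "D c (s - 2 * \<sigma>) = joint_weight j (c + d')"
      by (rule IH) (simp add: s_def algebra_simps Suc)
    ultimately show ?thesis
      using step b joint_weight_Suc [of j "c + d'"] unfolding s_def [symmetric]
      by (simp add: T1 ss Suc)
  next
    case 0
    have neg: "(s - 2 * \<sigma>) * s < 0" unfolding s3 by (simp add: 0)
    have d: "D c' (s - 2 * \<sigma>) = joint_weight j c'" for c'
      using IH [of "s - 2 * \<sigma>" 0 c'] 0 by (simp add: s_def)
    show ?thesis
    proof (cases c)
      case (Suc c')
      then show ?thesis
        using step b joint_weight_Suc [of j c'] unfolding s_def [symmetric]
        by (simp add: T1 ss T2 [OF neg] d 0)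
    next
      case c: 0
      then show ?thesis
        using step b joint_weight_Suc_0 [of j] unfolding s_def [symmetric]
        by (simp add: T1 ss T3 [OF neg] 0)
    qed
  qed
qed

text \<open>Summing the joint counts over the position telescopes, leaving two neighbouring binomial
coefficients that Pascal's rule combines.\<close>
lemma changes_count:
  "card {x \<in> sign_paths (2 * m + 1). path_changes x (2 * m + 1) = c} =
     2 * ((2 * m + 1) choose (m + 1 + c))"
proof -
  define A where "A \<sigma> d = {x \<in> sign_paths (2 * m + 1). path_changes x (2 * m + 1) = c \<and>
     path_walk x (2 * m + 1) = \<sigma> * (2 * real d + 1)}" for \<sigma> d
  have "{x \<in> sign_paths (2 * m + 1). path_changes x (2 * m + 1) = c}
    = (\<Union>(\<sigma>, d) \<in> {1, -1} \<times> {..m}. A \<sigma> d)"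
  proof (intro equalityI subsetI)
    fix x assume x: "x \<in> {x \<in> sign_paths (2 * m + 1). path_changes x (2 * m + 1) = c}"
    then have "x i \<in> {1, -1}" if "i \<in> {1..2 * m + 1}" for i
      using that unfolding sign_paths_def by auto
    then obtain d where "d \<le> m"
      "path_walk x (2 * m + 1) = 2 * real d + 1 \<or> path_walk x (2 * m + 1) = - (2 * real d + 1)"
      using path_walk_odd_time by blast
    then have "x \<in> A 1 d \<or> x \<in> A (-1) d" using x unfolding A_def by auto
    then show "x \<in> (\<Union>(\<sigma>, d) \<in> {1, -1} \<times> {..m}. A \<sigma> d)" using \<open>d \<le> m\<close> by auto
  qed (auto simp: A_def)
  moreover have "card (\<Union>(\<sigma>, d) \<in> {1, -1} \<times> {..m}. A \<sigma> d) =
      (\<Sum>(\<sigma>, d) \<in> {1, -1} \<times> {..m}. card (A \<sigma> d))"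
    by (subst card_UN_disjoint) (auto simp: A_def intro: sum.cong)
  ultimately have "int (card {x \<in> sign_paths (2 * m + 1). path_changes x (2 * m + 1) = c}) =
      (\<Sum>(\<sigma>, d) \<in> {1, -1} \<times> {..m}. int (card (A \<sigma> d)))"
    by (simp add: case_prod_unfold)
  also have "\<dots> = (\<Sum>(\<sigma>, d) \<in> {1, -1::real} \<times> {..m}. joint_weight m (c + d))"
    unfolding A_def using joint_count by (intro sum.cong refl) (clarify, blast)
  also have "\<dots> = 2 * (\<Sum>d\<le>m. joint_weight m (c + d))"
    by (simp add: sum.cartesian_product [symmetric])
  also have "(\<Sum>d\<le>k. joint_weight m (c + d)) =
      int (2 * m choose (m + c)) + int (2 * m choose (m + c + 1))
      - int (2 * m choose (m + c + k + 1)) - int (2 * m choose (m + c + k + 2))" for k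
    by (induction k) (auto simp: joint_weight_def add_ac)
  also have "2 * (int (2 * m choose (m + c)) + int (2 * m choose (m + c + 1))
      - int (2 * m choose (m + c + m + 1)) - int (2 * m choose (m + c + m + 2)))
      = int (2 * ((2 * m + 1) choose (m + 1 + c)))"
    by (simp add: binomial_eq_0 add_ac)
  finally show ?thesis by linarith
qed

section \<open>The law of the number of sign changes\<close>

text \<open>Explicit rules avoid handing the equality of laws to the simplifier, which would rewrite \<open>X 1\<close> to
itself.\<close>
lemma simple_symmetric_stepsD:
  assumes "simple_symmetric_steps M X"
  shows "prob_space M" and "prob_space.indep_vars M (\<lambda>_. borel) X {1..}"
    and "j \<ge> 1 \<Longrightarrow> distr M borel (X j) = distr M borel (X 1)"
    and "s \<in> {1, -1} \<Longrightarrow> measure M {\<omega> \<in> space M. X 1 \<omega> = s} = 1 / 2"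
proof -
  note X = assms [unfolded simple_symmetric_steps_def]
  show "prob_space M" using X by (rule conjunct1)
  note X = X [THEN conjunct2]
  show "prob_space.indep_vars M (\<lambda>_. borel) X {1..}" using X by (rule conjunct1)
  note X = X [THEN conjunct2]
  show "distr M borel (X j) = distr M borel (X 1)" if "j \<ge> 1" using X [THEN conjunct1] that by blast
  note X = X [THEN conjunct2]
  show "measure M {\<omega> \<in> space M. X 1 \<omega> = s} = 1 / 2" if "s \<in> {1, -1}"
    using that X by (elim insertE conjE emptyE) simp_all
qed

lemma steps_measurable:
  assumes "simple_symmetric_steps M X" and "j \<ge> 1"
  shows "X j \<in> borel_measurable M"
proof -
  interpret prob_space M by (rule simple_symmetric_stepsD [OF assms(1)])
  have "indep_vars (\<lambda>_. borel) X {1..}" by (rule simple_symmetric_stepsD [OF assms(1)])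
  then have "\<forall>i\<in>{1..}. X i \<in> borel_measurable M" unfolding indep_vars_def by (rule conjunct1)
  then show ?thesis using assms(2) by blast
qed

lemma path_probability:
  assumes X: "simple_symmetric_steps M X" and "n \<ge> 1" and x: "x \<in> sign_paths n"
  shows "measure M {\<omega> \<in> space M. \<forall>j\<in>{1..n}. X j \<omega> = x j} = 1 / 2 ^ n"
proof -
  interpret prob_space M by (rule simple_symmetric_stepsD [OF X])
  have half: "prob (X j -` {x j} \<inter> space M) = 1 / 2" if j: "j \<in> {1..n}" for j
  proof -
    have "x j \<in> {1, -1}"
      using PiE_mem [of x "{1..n}" "\<lambda>_. {1, -1}" j] x j unfolding sign_paths_def by simp
    moreover have "prob (X j -` {s} \<inter> space M) = prob {\<omega> \<in> space M. X 1 \<omega> = s}" for s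
    proof -
      have "distr M borel (X j) = distr M borel (X 1)"
        using j by (intro simple_symmetric_stepsD(3) [OF X]) simp
      then have "measure (distr M borel (X j)) {s} = measure (distr M borel (X 1)) {s}" by simp
      moreover have "measure (distr M borel (X i)) {s} = prob (X i -` {s} \<inter> space M)"
        if "i \<ge> 1" for i
        by (rule measure_distr) (use that steps_measurable [OF X] in auto)
      ultimately have "prob (X j -` {s} \<inter> space M) = prob (X 1 -` {s} \<inter> space M)"
        using j by auto
      also have "X 1 -` {s} \<inter> space M = {\<omega> \<in> space M. X 1 \<omega> = s}" by auto
      finally show ?thesis .
    qed
    ultimately show ?thesis
      using simple_symmetric_stepsD(4) [OF X] by simp
  qed
  have "{\<omega> \<in> space M. \<forall>j\<in>{1..n}. X j \<omega> = x j} = (\<Inter>j\<in>{1..n}. X j -` {x j} \<inter> space M)"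
    using \<open>n \<ge> 1\<close> by auto
  also have "prob \<dots> = (\<Prod>j\<in>{1..n}. prob (X j -` {x j} \<inter> space M))"
    using \<open>n \<ge> 1\<close>
    by (intro indep_varsD [OF simple_symmetric_stepsD(2) [OF X]]) auto
  also have "\<dots> = (\<Prod>j\<in>{1..n}. 1 / 2)"
    by (intro prod.cong refl half)
  also have "\<dots> = 1 / 2 ^ n"
    by (simp add: power_divide)
  finally show ?thesis .
qed

text \<open>Almost every outcome follows one of the finitely many sign paths, and these are equally likely. This
turns probabilities of events determined by the first \<open>n\<close> steps into counts.\<close>
lemma path_event_probability:
  assumes X: "simple_symmetric_steps M X" and "n \<ge> 1"
    and Q: "\<And>x y. (\<And>i. i \<in> {1..n} \<Longrightarrow> x i = y i) \<Longrightarrow> Q x = Q y"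
    and meas: "{\<omega> \<in> space M. Q (\<lambda>j. X j \<omega>)} \<in> sets M"
  shows "measure M {\<omega> \<in> space M. Q (\<lambda>j. X j \<omega>)} = card {x \<in> sign_paths n. Q x} / 2 ^ n"
proof -
  interpret prob_space M by (rule simple_symmetric_stepsD [OF X])
  define B where "B x = {\<omega> \<in> space M. \<forall>j\<in>{1..n}. X j \<omega> = x j}" for x
  have [measurable]: "X j \<in> borel_measurable M" if "j \<in> {1..n}" for j
    using steps_measurable [OF X] that by auto
  have Bm: "B x \<in> events" for x unfolding B_def by measurable
  have disj: "disjoint_family_on B (sign_paths n)"
    unfolding disjoint_family_on_def
  proof (intro ballI impI)
    fix x y assume "x \<in> sign_paths n" "y \<in> sign_paths n" "x \<noteq> y"
    then obtain j where "j \<in> {1..n}" "x j \<noteq> y j"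
      unfolding sign_paths_def by (meson PiE_ext)
    then show "B x \<inter> B y = {}" unfolding B_def disjoint_iff mem_Collect_eq by metis
  qed
  have sum: "prob (\<Union>x\<in>S. B x) = card S / 2 ^ n" if "S \<subseteq> sign_paths n" for S
  proof -
    have "prob (\<Union>x\<in>S. B x) = (\<Sum>x\<in>S. prob (B x))"
      using that Bm disjoint_family_on_mono [OF that disj] finite_subset [OF that]
      by (intro finite_measure_finite_Union) auto
    also have "\<dots> = (\<Sum>x\<in>S. 1 / 2 ^ n)"
      using path_probability [OF X \<open>n \<ge> 1\<close>] that by (intro sum.cong) (auto simp: B_def)
    finally show ?thesis by simp
  qed
  have "card (sign_paths n) = 2 ^ n"
    unfolding sign_paths_def by (simp add: card_PiE numeral_2_eq_2)
  then have "prob (\<Union>x\<in>sign_paths n. B x) = 1" using sum [of "sign_paths n"] by simp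
  moreover have un: "(\<Union>x\<in>S. B x) \<in> events" if "S \<subseteq> sign_paths n" for S
    using finite_subset [OF that] Bm by (intro sets.finite_UN) auto
  ultimately have ae: "AE \<omega> in M. \<omega> \<in> (\<Union>x\<in>sign_paths n. B x)"
    using prob_eq_1 [OF un [OF order_refl]] by blast
  have iff: "\<omega> \<in> (\<Union>x\<in>{x \<in> sign_paths n. Q x}. B x) \<longleftrightarrow> Q (\<lambda>j. X j \<omega>)"
    if "\<omega> \<in> (\<Union>x\<in>sign_paths n. B x)" for \<omega>
  proof -
    have "Q (\<lambda>j. X j \<omega>) = Q x" if "\<omega> \<in> B x" for x
      by (rule Q) (use that in \<open>simp add: B_def\<close>)
    then show ?thesis using that by blast
  qed
  have "AE \<omega> in M. (\<omega> \<in> {\<omega> \<in> space M. Q (\<lambda>j. X j \<omega>)}) = (\<omega> \<in> (\<Union>x\<in>{x \<in> sign_paths n. Q x}. B x))"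
    using ae AE_space
  proof eventually_elim
    case (elim \<omega>)
    show ?case using iff [OF elim(1)] elim(2) by blast
  qed
  then have "prob {\<omega> \<in> space M. Q (\<lambda>j. X j \<omega>)} = prob (\<Union>x\<in>{x \<in> sign_paths n. Q x}. B x)"
    by (rule finite_measure_eq_AE) (use meas in \<open>auto intro!: un\<close>)
  then show ?thesis using sum [of "{x \<in> sign_paths n. Q x}"] by simp
qed

lemma walk_measurable:
  assumes "simple_symmetric_steps M X"
  shows "walk X k \<in> borel_measurable M"
proof -
  have "walk X k = (\<lambda>\<omega>. \<Sum>j = 1..k. X j \<omega>)" by (rule ext) (simp add: walk_def)
  moreover have "(\<lambda>\<omega>. \<Sum>j = 1..k. X j \<omega>) \<in> borel_measurable M"
    by (intro borel_measurable_sum steps_measurable [OF assms]) simp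
  ultimately show ?thesis by simp
qed

lemma sign_changes_measurable:
  assumes "simple_symmetric_steps M X"
  shows "sign_changes X n \<in> measurable M (count_space UNIV)"
proof -
  note [measurable] = walk_measurable [OF assms]
  have "(\<lambda>\<omega>. card {k \<in> {1..<n}. walk X (k - 1) \<omega> * walk X (k + 1) \<omega> < 0})
    \<in> measurable M (count_space UNIV)" by measurable
  moreover have "sign_changes X n =
      (\<lambda>\<omega>. card {k \<in> {1..<n}. walk X (k - 1) \<omega> * walk X (k + 1) \<omega> < 0})"
    by (rule ext) (simp add: sign_changes_def)
  ultimately show ?thesis by simp
qed

definition sign_change_prob :: "nat \<Rightarrow> nat \<Rightarrow> real" where
  "sign_change_prob m c = real ((2 * m + 1) choose (m + 1 + c)) / 4 ^ m"

lemma sign_change_prob_eq_0: "c > m \<Longrightarrow> sign_change_prob m c = 0"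
  unfolding sign_change_prob_def by (subst binomial_eq_0) auto

lemma sign_changes_distribution:
  assumes X: "simple_symmetric_steps M X"
  shows "measure M {\<omega> \<in> space M. sign_changes X (2 * m + 1) \<omega> = c} = sign_change_prob m c"
proof -
  have eq: "sign_changes X n \<omega> = path_changes (\<lambda>j. X j \<omega>) n" for n \<omega>
    by (simp add: sign_changes_def walk_def)
  note [measurable] = sign_changes_measurable [OF X]
  have "{\<omega> \<in> space M. sign_changes X (2 * m + 1) \<omega> = c} \<in> sets M" by measurable
  then have "measure M {\<omega> \<in> space M. path_changes (\<lambda>j. X j \<omega>) (2 * m + 1) = c}
    = real (card {x \<in> sign_paths (2 * m + 1). path_changes x (2 * m + 1) = c}) / 2 ^ (2 * m + 1)"
    unfolding eq
  proof (intro path_event_probability [OF X])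
    fix x y :: "nat \<Rightarrow> real" assume "\<And>i. i \<in> {1..2 * m + 1} \<Longrightarrow> x i = y i"
    then have "path_changes x (2 * m + 1) = path_changes y (2 * m + 1)" by (rule path_changes_cong)
    then show "(path_changes x (2 * m + 1) = c) = (path_changes y (2 * m + 1) = c)" by simp
  qed auto
  moreover have "real (2 * b) / 2 ^ (2 * m + 1) = real b / 4 ^ m" for b
    by (simp add: power_mult)
  ultimately show ?thesis
    unfolding eq changes_count sign_change_prob_def by (simp only:)
qed

lemma sign_changes_expectation:
  fixes \<phi> :: "nat \<Rightarrow> real"
  assumes X: "simple_symmetric_steps M X"
  shows "(\<integral>\<omega>. \<phi> (sign_changes X (2 * m + 1) \<omega>) \<partial>M) = (\<Sum>c\<le>m. sign_change_prob m c * \<phi> c)"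
proof -
  interpret prob_space M by (rule simple_symmetric_stepsD [OF X])
  let ?C = "sign_changes X (2 * m + 1)"
  note [measurable] = sign_changes_measurable [OF X]
  define E where "E c = {\<omega> \<in> space M. ?C \<omega> = c}" for c
  have [measurable]: "E c \<in> events" for c unfolding E_def by measurable
  have le: "?C \<omega> \<le> 2 * m" for \<omega>
  proof -
    have "?C \<omega> \<le> card {1..<2 * m + 1}" unfolding sign_changes_def by (intro card_mono) auto
    then show ?thesis by simp
  qed
  have "(\<integral>\<omega>. \<phi> (?C \<omega>) \<partial>M) = (\<integral>\<omega>. (\<Sum>c\<le>2 * m. \<phi> c * indicator (E c) \<omega>) \<partial>M)"
  proof (rule Bochner_Integration.integral_cong [OF refl])
    fix \<omega> assume w: "\<omega> \<in> space M"
    have "(\<Sum>c\<le>2 * m. \<phi> c * indicator (E c) \<omega>) = (\<Sum>c\<le>2 * m. if c = ?C \<omega> then \<phi> c else 0)"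
      by (intro sum.cong) (use w in \<open>auto simp: E_def\<close>)
    then show "\<phi> (?C \<omega>) = (\<Sum>c\<le>2 * m. \<phi> c * indicator (E c) \<omega>)"
      using le [of \<omega>] by simp
  qed
  also have "\<dots> = (\<Sum>c\<le>2 * m. \<phi> c * prob (E c))"
    by (subst Bochner_Integration.integral_sum) (auto simp: emeasure_eq_measure)
  also have "\<dots> = (\<Sum>c\<le>2 * m. sign_change_prob m c * \<phi> c)"
    unfolding E_def sign_changes_distribution [OF X] by (simp add: mult.commute)
  also have "\<dots> = (\<Sum>c\<le>m. sign_change_prob m c * \<phi> c)"
    by (intro sum.mono_neutral_right) (auto simp: sign_change_prob_eq_0)
  finally show ?thesis .
qed

lemma sign_change_prob_nonneg: "sign_change_prob m c \<ge> 0"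
  by (simp add: sign_change_prob_def)

lemma sum_sign_change_prob: "(\<Sum>c\<le>m. sign_change_prob m c) = 1"
proof -
  \<comment> \<open>By symmetry, this is the lower half of an odd row of Pascal's triangle.\<close>
  have "(\<Sum>c\<le>m. (2 * m + 1) choose (m + 1 + c)) = (\<Sum>c\<le>m. (2 * m + 1) choose (m - c))"
    by (intro sum.cong refl, subst binomial_symmetric) auto
  also have "\<dots> = (\<Sum>c\<le>m. (2 * m + 1) choose c)"
    using sum.nat_diff_reindex [of "\<lambda>c. (2 * m + 1) choose c" "Suc m"]
    by (simp add: lessThan_Suc_atMost)
  also have "\<dots> = 4 ^ m"
    by (simp only: binomial_r_part_sum power_mult) simp
  finally show ?thesis
    unfolding sign_change_prob_def sum_divide_distrib [symmetric] of_nat_sum [symmetric] by simp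
qed

text \<open>This ratio of consecutive probabilities characterises the law of the sign changes; it is what the
discrete Stein identity rests on.\<close>
lemma sign_change_prob_Suc:
  "(real m + 2 + real c) * sign_change_prob m (Suc c) = (real m - real c) * sign_change_prob m c"
proof (cases "c \<le> m")
  case True
  have "Suc (m + 1 + c) * ((2 * m + 1) choose Suc (m + 1 + c)) =
    (2 * m + 1 - (m + 1 + c)) * ((2 * m + 1) choose (m + 1 + c))"
    by (simp only: binomial_absorption binomial_absorb_comp)
  then have "real (Suc (m + 1 + c)) * real ((2 * m + 1) choose Suc (m + 1 + c)) =
    real (2 * m + 1 - (m + 1 + c)) * real ((2 * m + 1) choose (m + 1 + c))"
    by (metis of_nat_mult)
  then show ?thesis using True
    by (simp add: sign_change_prob_def field_simps)
qed (simp add: sign_change_prob_eq_0)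

section \<open>The Stein equation of the half-normal distribution\<close>

text \<open>A function that vanishes at infinity is minus the tail integral of its derivative, so an inequality between derivatives
carries over to the functions. All bounds for the Stein solution follow from this with explicit
elementary functions \<open>G\<close>, without any reference to the Gaussian tail integral.\<close>
lemma abs_le_by_tail_comparison:
  fixes D G D' G' :: "real \<Rightarrow> real"
  assumes D: "\<And>t. t \<ge> x \<Longrightarrow> (D has_real_derivative D' t) (at t)"
    and G: "\<And>t. t \<ge> x \<Longrightarrow> (G has_real_derivative G' t) (at t)"
    and le: "\<And>t. t \<ge> x \<Longrightarrow> \<bar>D' t\<bar> \<le> - G' t"
    and lim: "(D \<longlongrightarrow> 0) at_top" "(G \<longlongrightarrow> 0) at_top"
  shows "\<bar>D x\<bar> \<le> G x"
proof -
  have pos: "0 \<le> H x"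
    if H: "\<And>t. t \<ge> x \<Longrightarrow> (H has_real_derivative H' t) (at t)"
      and neg: "\<And>t. t \<ge> x \<Longrightarrow> H' t \<le> 0" and "(H \<longlongrightarrow> 0) at_top" for H H' :: "real \<Rightarrow> real"
  proof -
    have "H y \<le> H x" if "y \<ge> x" for y
      by (rule DERIV_nonpos_imp_nonincreasing [OF that]) (use H neg in blast)
    then have "eventually (\<lambda>y. H y \<le> H x) at_top"
      by (intro eventually_at_top_linorderI [of x]) auto
    then show ?thesis
      by (rule tendsto_upperbound [OF that(3)]) simp
  qed
  have "0 \<le> G x - D x"
  proof (rule pos [of "\<lambda>t. G t - D t" "\<lambda>t. G' t - D' t"])
    show "((\<lambda>t. G t - D t) has_real_derivative G' t - D' t) (at t)" if "t \<ge> x" for t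
      by (intro DERIV_diff D G that)
    show "G' t - D' t \<le> 0" if "t \<ge> x" for t using le [OF that] by linarith
    show "((\<lambda>t. G t - D t) \<longlongrightarrow> 0) at_top" using tendsto_diff [OF lim(2,1)] by simp
  qed
  moreover have "0 \<le> G x + D x"
  proof (rule pos [of "\<lambda>t. G t + D t" "\<lambda>t. G' t + D' t"])
    show "((\<lambda>t. G t + D t) has_real_derivative G' t + D' t) (at t)" if "t \<ge> x" for t
      by (intro DERIV_add D G that)
    show "G' t + D' t \<le> 0" if "t \<ge> x" for t using le [OF that] by linarith
    show "((\<lambda>t. G t + D t) \<longlongrightarrow> 0) at_top" using tendsto_add [OF lim(2,1)] by simp
  qed
  ultimately show ?thesis by linarith
qed

definition gauss_primitive :: "(real \<Rightarrow> real) \<Rightarrow> real \<Rightarrow> real \<Rightarrow> real" where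
  "gauss_primitive h c x = integral {0..x} (\<lambda>t. (h t - c) * exp (- t\<^sup>2 / 2))"

text \<open>The solution, vanishing at 0, of the Stein equation \<open>f' x = x * f x + h x - c\<close> of the half-normal
distribution. Its derivative stays bounded when \<open>c\<close> is the half-normal mean of \<open>h\<close>.\<close>
definition stein_solution :: "(real \<Rightarrow> real) \<Rightarrow> real \<Rightarrow> real \<Rightarrow> real" where
  "stein_solution h c x = exp (x\<^sup>2 / 2) * gauss_primitive h c x"

lemma gauss_primitive_deriv:
  assumes "continuous_on UNIV h" and "x > 0"
  shows "(gauss_primitive h c has_real_derivative (h x - c) * exp (- x\<^sup>2 / 2)) (at x)"
proof -
  have "continuous_on {0..x + 1} (\<lambda>t. (h t - c) * exp (- t\<^sup>2 / 2))"
    by (intro continuous_intros continuous_on_subset [OF assms(1)]) auto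
  then have "((\<lambda>x. integral {0..x} (\<lambda>t. (h t - c) * exp (- t\<^sup>2 / 2))) has_real_derivative
      (h x - c) * exp (- x\<^sup>2 / 2)) (at x within {0..x + 1})"
    using \<open>x > 0\<close> by (intro integral_has_real_derivative) auto
  moreover have "at x within {0..x + 1} = at x" using \<open>x > 0\<close> by (intro at_within_Icc_at) auto
  ultimately show ?thesis unfolding gauss_primitive_def by simp
qed

lemma stein_solution_deriv:
  assumes "continuous_on UNIV h" and "x > 0"
  shows "(stein_solution h c has_real_derivative x * stein_solution h c x + h x - c) (at x)"
proof -
  have "((\<lambda>x. exp (x\<^sup>2 / 2) * gauss_primitive h c x) has_real_derivative
     (exp (x\<^sup>2 / 2) * x) * gauss_primitive h c x + (h x - c) * exp (- x\<^sup>2 / 2) * exp (x\<^sup>2 / 2)) (at x)"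
    by (rule DERIV_mult' [THEN DERIV_cong] gauss_primitive_deriv assms
        derivative_eq_intros refl | simp)+
  also have "(h x - c) * exp (- x\<^sup>2 / 2) * exp (x\<^sup>2 / 2) = h x - c"
    by (simp add: exp_minus field_simps)
  finally show ?thesis unfolding stein_solution_def by (simp add: algebra_simps)
qed

lemma stein_solution_continuous:
  assumes "continuous_on UNIV h" and "0 \<le> a"
  shows "continuous_on {a..b} (stein_solution h c)"
proof -
  have "continuous_on {0..b} (\<lambda>x. integral {0..x} (\<lambda>t. (h t - c) * exp (- t\<^sup>2 / 2)))"
    by (intro indefinite_integral_continuous_1 integrable_continuous_interval continuous_intros
        continuous_on_subset [OF assms(1)]) auto
  then have "continuous_on {0..b} (gauss_primitive h c)"
    unfolding gauss_primitive_def .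
  then have "continuous_on {0..b} (stein_solution h c)"
    unfolding stein_solution_def by (intro continuous_intros) simp
  then show ?thesis by (rule continuous_on_subset) (use \<open>0 \<le> a\<close> in auto)
qed

lemma stein_solution_0 [simp]: "stein_solution h c 0 = 0"
  by (simp add: stein_solution_def gauss_primitive_def)

text \<open>The limit is, up to a factor, the half-normal mean of \<open>h - c\<close>, hence 0 for this choice of \<open>c\<close>. The
symmetry of \<open>h \<bar>z\<bar>\<close> lets the whole line stand in for the half line.\<close>
lemma gauss_primitive_tendsto_0:
  assumes h: "continuous_on UNIV h"
    and int: "integrable lborel (\<lambda>z. std_normal_density z * h \<bar>z\<bar>)"
    and c: "c = (\<integral>z. std_normal_density z * h \<bar>z\<bar> \<partial>lborel)"
  shows "(gauss_primitive h c \<longlongrightarrow> 0) at_top"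
proof -
  define g where "g z = std_normal_density z * (h \<bar>z\<bar> - c)" for z
  define g0 where "g0 z = indicator {0..} z *\<^sub>R g z" for z :: real
  have idens: "integrable lborel std_normal_density"
    "(\<integral>z. std_normal_density z \<partial>lborel) = 1"
    using integrable_std_normal_moment [of 0] integral_std_normal_moment_even [of 0] by simp_all
  have g: "integrable lborel g" "(\<integral>z. g z \<partial>lborel) = 0"
    unfolding g_def right_diff_distrib using int idens c by simp_all
  have g0: "integrable lborel g0"
    unfolding g0_def by (rule integrable_mult_indicator) (use g in auto)
  have "has_bochner_integral lborel g (2 *\<^sub>R (\<integral>z. g0 z \<partial>lborel))"
  proof (rule has_bochner_integral_even_function)
    show "has_bochner_integral lborel (\<lambda>x. indicator {0..} x *\<^sub>R g x) (\<integral>z. g0 z \<partial>lborel)"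
      using g0 unfolding g0_def by (simp add: has_bochner_integral_integrable)
    show "g (- x) = g x" for x by (simp add: g_def std_normal_density_def)
  qed
  then have I0: "(\<integral>z. g0 z \<partial>lborel) = 0"
    using g(2) by (simp add: has_bochner_integral_integral_eq)
  have eq: "(\<integral>x. indicator {..y} x *\<^sub>R g0 x \<partial>lborel) = gauss_primitive h c y / sqrt (2 * pi)" for y
  proof -
    have "(\<integral>x. indicator {..y} x *\<^sub>R g0 x \<partial>lborel) = (LINT x:{0..y}|lborel. g x)"
      unfolding set_lebesgue_integral_def g0_def
      by (intro Bochner_Integration.integral_cong) (auto simp: indicator_def)
    also have "\<dots> = integral {0..y} g"
      by (rule set_borel_integral_eq_integral)
        (unfold set_integrable_def, rule integrable_mult_indicator, use g in auto)
    also have "\<dots> = integral {0..y} (\<lambda>t. (1 / sqrt (2 * pi)) * ((h t - c) * exp (- t\<^sup>2 / 2)))"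
      by (intro Henstock_Kurzweil_Integration.integral_cong)
        (auto simp: g_def std_normal_density_def)
    also have "\<dots> = gauss_primitive h c y / sqrt (2 * pi)"
      unfolding gauss_primitive_def Henstock_Kurzweil_Integration.integral_mult_right by simp
    finally show ?thesis .
  qed
  have "((\<lambda>y. gauss_primitive h c y / sqrt (2 * pi)) \<longlongrightarrow> 0) at_top"
    using tendsto_integral_at_top [OF _ g0] unfolding eq I0 by simp
  then have "((\<lambda>y. sqrt (2 * pi) * (gauss_primitive h c y / sqrt (2 * pi))) \<longlongrightarrow> sqrt (2 * pi) * 0) at_top"
    by (rule tendsto_mult_left)
  then show ?thesis by simp
qed

text \<open>The primitive is dominated by \<open>exp (- x\<^sup>2 / 2) / x\<close>, the classical upper bound for the Gaussian tail, so
\<open>x * f x\<close> is at most 1 in absolute value.\<close>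
lemma stein_deriv_bound_bounded:
  assumes h: "continuous_on UNIV h" and lim: "(gauss_primitive h c \<longlongrightarrow> 0) at_top"
    and bd: "\<And>t. \<bar>h t - c\<bar> \<le> 1" and "x > 0"
  shows "\<bar>x * stein_solution h c x + h x - c\<bar> \<le> 2"
proof -
  have "\<bar>gauss_primitive h c x\<bar> \<le> exp (- x\<^sup>2 / 2) / x"
  proof (rule abs_le_by_tail_comparison [where D = "gauss_primitive h c"
        and D' = "\<lambda>t. (h t - c) * exp (- t\<^sup>2 / 2)" and G = "\<lambda>t. exp (- t\<^sup>2 / 2) / x"
        and G' = "\<lambda>t. - (t * exp (- t\<^sup>2 / 2) / x)"])
    fix t assume t: "t \<ge> x"
    show "(gauss_primitive h c has_real_derivative (h t - c) * exp (- t\<^sup>2 / 2)) (at t)"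
      using t \<open>x > 0\<close> by (intro gauss_primitive_deriv h) simp
    show "((\<lambda>t. exp (- t\<^sup>2 / 2) / x) has_real_derivative - (t * exp (- t\<^sup>2 / 2) / x)) (at t)"
      using \<open>x > 0\<close> by (auto intro!: derivative_eq_intros simp: field_simps)
    have "\<bar>(h t - c) * exp (- t\<^sup>2 / 2)\<bar> \<le> 1 * exp (- t\<^sup>2 / 2)"
      unfolding abs_mult by (intro mult_mono bd) auto
    also have "\<dots> \<le> (t / x) * exp (- t\<^sup>2 / 2)"
      using t \<open>x > 0\<close> by (intro mult_right_mono) auto
    finally show "\<bar>(h t - c) * exp (- t\<^sup>2 / 2)\<bar> \<le> - (- (t * exp (- t\<^sup>2 / 2) / x))" by simp
  next
    show "((\<lambda>t. exp (- t\<^sup>2 / 2) / x) \<longlongrightarrow> 0) at_top" using \<open>x > 0\<close> by real_asymp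
  qed (rule lim)
  then have "x * exp (x\<^sup>2 / 2) * \<bar>gauss_primitive h c x\<bar> \<le> x * exp (x\<^sup>2 / 2) * (exp (- x\<^sup>2 / 2) / x)"
    using \<open>x > 0\<close> by (intro mult_left_mono) auto
  also have "\<dots> = 1" using \<open>x > 0\<close> by (simp add: exp_minus field_simps)
  finally have "\<bar>x * stein_solution h c x\<bar> \<le> 1"
    using \<open>x > 0\<close> by (simp add: stein_solution_def abs_mult)
  then show ?thesis using bd [of x] by linarith
qed

text \<open>For fixed \<open>x\<close> the derivative of the solution at \<open>x\<close> is \<open>exp (x\<^sup>2 / 2) * D x\<close> with \<open>D\<close> as in the proof. The
Lipschitz condition bounds the derivative of \<open>D\<close> at \<open>t\<close> by a multiple of \<open>(t - x) * exp (- t\<^sup>2 / 2)\<close>,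
whose tail integral is at most \<open>exp (- x\<^sup>2 / 2) / (1 + x\<^sup>2)\<close>. The factor \<open>1 / (1 + x\<^sup>2)\<close> compensates the
linear growth of \<open>h\<close>.\<close>
lemma stein_deriv_bound_lipschitz:
  assumes h: "1-lipschitz_on UNIV h" and lim: "(gauss_primitive h c \<longlongrightarrow> 0) at_top"
    and h0: "\<bar>h 0 - c\<bar> \<le> 1" and "x > 0"
  shows "\<bar>x * stein_solution h c x + h x - c\<bar> \<le> 2"
proof -
  have lip: "\<bar>h s - h t\<bar> \<le> \<bar>s - t\<bar>" for s t
    using lipschitz_onD [OF h, of s t] by (simp add: dist_real_def)
  have cont: "continuous_on UNIV h" by (rule lipschitz_on_continuous_on [OF h])
  define a where "a = h x - c"
  define D where "D t = x * gauss_primitive h c t + a * exp (- t\<^sup>2 / 2)" for t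
  define b where "b = (x + \<bar>a\<bar>) / (1 + x\<^sup>2)"
  have x2: "1 + x\<^sup>2 > 0" by (simp add: add_pos_nonneg)
  \<comment> \<open>The linear factor of the dominating function is the one for which its derivative vanishes to
    first order at \<open>t = x\<close>, as the bound for the derivative of \<open>D\<close> does.\<close>
  have "\<bar>D x\<bar> \<le> b * (exp (- x\<^sup>2 / 2) * (1 + x * (x - x)))"
  proof (rule abs_le_by_tail_comparison [where D = D
        and D' = "\<lambda>t. x * ((h t - c) * exp (- t\<^sup>2 / 2)) - a * t * exp (- t\<^sup>2 / 2)"
        and G = "\<lambda>t. b * (exp (- t\<^sup>2 / 2) * (1 + x * (t - x)))"
        and G' = "\<lambda>t. b * (x * exp (- t\<^sup>2 / 2) - t * exp (- t\<^sup>2 / 2) * (1 + x * (t - x)))"])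
    fix t assume t: "t \<ge> x"
    let ?e = "exp (- t\<^sup>2 / 2)"
    show "(D has_real_derivative x * ((h t - c) * ?e) - a * t * ?e) (at t)"
      unfolding D_def using t \<open>x > 0\<close>
      by (auto intro!: derivative_eq_intros gauss_primitive_deriv cont)
    show "((\<lambda>t. b * (exp (- t\<^sup>2 / 2) * (1 + x * (t - x)))) has_real_derivative
        b * (x * ?e - t * ?e * (1 + x * (t - x)))) (at t)"
      by (auto intro!: derivative_eq_intros simp: algebra_simps)
    have "x * ((h t - c) * ?e) - a * t * ?e = (x * (h t - h x) - a * (t - x)) * ?e"
      by (simp add: a_def algebra_simps)
    also have "\<bar>\<dots>\<bar> \<le> ((x + \<bar>a\<bar>) * (t - x)) * ?e"
    proof -
      have "\<bar>x * (h t - h x) - a * (t - x)\<bar> \<le> \<bar>x * (h t - h x)\<bar> + \<bar>a * (t - x)\<bar>" by linarith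
      also have "\<dots> \<le> x * (t - x) + \<bar>a\<bar> * (t - x)"
        unfolding abs_mult using lip [of t x] t \<open>x > 0\<close>
        by (intro add_mono mult_mono) auto
      finally show ?thesis
        using mult_right_mono [of _ _ ?e] by (fastforce simp: abs_mult distrib_right)
    qed
    also have "\<dots> = b * ((1 + x\<^sup>2) * (t - x)) * ?e" using x2 by (simp add: b_def)
    also have "\<dots> \<le> b * ((1 + x\<^sup>2) * (t - x) + x * (t - x)\<^sup>2) * ?e"
      using \<open>x > 0\<close> x2 by (intro mult_right_mono mult_left_mono) (auto simp: b_def)
    also have "\<dots> = - (b * (x * ?e - t * ?e * (1 + x * (t - x))))"
      by (simp add: algebra_simps power2_eq_square)
    finally show "\<bar>x * ((h t - c) * ?e) - a * t * ?e\<bar> \<le> - (b * (x * ?e - t * ?e * (1 + x * (t - x))))" .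
  next
    have "((\<lambda>t. exp (- t\<^sup>2 / 2)) \<longlongrightarrow> (0::real)) at_top" by real_asymp
    then have "((\<lambda>t. x * gauss_primitive h c t + a * exp (- t\<^sup>2 / 2)) \<longlongrightarrow> x * 0 + a * 0) at_top"
      by (intro tendsto_intros lim)
    then show "(D \<longlongrightarrow> 0) at_top" unfolding D_def by simp
    have "((\<lambda>t. exp (- t\<^sup>2 / 2) * (1 + x * (t - x))) \<longlongrightarrow> 0) at_top"
      using \<open>x > 0\<close> by real_asymp
    from tendsto_mult_left [OF this, of b]
    show "((\<lambda>t. b * (exp (- t\<^sup>2 / 2) * (1 + x * (t - x)))) \<longlongrightarrow> 0) at_top" by simp
  qed
  then have "exp (x\<^sup>2 / 2) * \<bar>D x\<bar> \<le> exp (x\<^sup>2 / 2) * (b * exp (- x\<^sup>2 / 2))"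
    by (intro mult_left_mono) auto
  also have "\<dots> = b" by (simp add: exp_minus)
  also have "\<dots> \<le> 2"
  proof -
    have "\<bar>a\<bar> \<le> x + 1" using lip [of x 0] h0 \<open>x > 0\<close> by (simp add: a_def)
    moreover have "2 * x \<le> 1 + 2 * x\<^sup>2"
      using sum_squares_ge_zero [of "x - 1 / 2" "x - 1 / 2"] by (simp add: power2_eq_square algebra_simps)
    ultimately have "x + \<bar>a\<bar> \<le> 2 * (1 + x\<^sup>2)" unfolding distrib_left by linarith
    then show ?thesis using x2 by (simp add: b_def pos_divide_le_eq)
  qed
  finally have "\<bar>exp (x\<^sup>2 / 2) * D x\<bar> \<le> 2" by (simp add: abs_mult)
  also have "exp (x\<^sup>2 / 2) * D x = x * stein_solution h c x + h x - c"
    by (simp add: D_def a_def stein_solution_def distrib_left exp_minus)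
  finally show ?thesis .
qed

text \<open>Integrating the Stein equation over \<open>[a, a + d]\<close> gives
\<open>(f (a + d) - f a) / d\<close> as the mean of \<open>t * f t\<close> plus the mean of \<open>h\<close> minus \<open>c\<close>. So the left-hand side
compares the mean of \<open>t * f t\<close> with its trapezoidal approximation (midpoint times mean of the end
values), and the error is controlled by the Lipschitz constant \<open>K\<close> of \<open>f\<close>.\<close>
lemma trapezoid_step:
  fixes f h :: "real \<Rightarrow> real"
  assumes h: "continuous_on UNIV h" and "d > 0" and a: "0 \<le> a" and K: "0 \<le> K"
    and f: "continuous_on {a..a + d} f"
    and f': "\<And>t. a < t \<Longrightarrow> (f has_real_derivative t * f t + h t - c) (at t)"
    and bd: "\<And>t. a < t \<Longrightarrow> \<bar>t * f t + h t - c\<bar> \<le> K"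
  shows "\<bar>integral {a..a + d} h / d - c -
      ((f (a + d) - f a) / d - (a + d / 2) * ((f a + f (a + d)) / 2))\<bar>
    \<le> K * ((a + d / 2) * (d / 2) + d\<^sup>2 / 4)"
proof -
  define b where "b = a + d"
  define mid where "mid = a + d / 2"
  define B where "B = K * (mid * (d / 2) + d\<^sup>2 / 4)"
  have mid: "mid \<ge> 0" "B \<ge> 0" using \<open>d > 0\<close> a K by (auto simp: mid_def B_def)
  have lip1: "\<bar>f t - f s\<bar> \<le> K * (t - s)" if "a \<le> s" "s < t" "t \<le> b" for s t
  proof -
    have "\<exists>l z. s < z \<and> z < t \<and> DERIV f z :> l \<and> f t - f s = (t - s) * l"
    proof (rule MVT [OF \<open>s < t\<close>])
      show "continuous_on {s..t} f"
        by (rule continuous_on_subset [OF f]) (use that in \<open>auto simp: b_def\<close>)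
      show "f differentiable at x" if "s < x" for x
        using f' [of x] that \<open>a \<le> s\<close> by (auto simp: real_differentiable_def)
    qed
    then obtain l z where z: "s < z" "DERIV f z :> l" "f t - f s = (t - s) * l" by blast
    have "a < z" using z that by simp
    then have "\<bar>l\<bar> \<le> K" using bd [of z] DERIV_unique [OF z(2) f' [of z]] by simp
    then show ?thesis using z(3) \<open>s < t\<close> by (simp add: abs_mult mult.commute mult_left_mono)
  qed
  have lip: "\<bar>f t - f s\<bar> \<le> K * \<bar>t - s\<bar>" if "s \<in> {a..b}" "t \<in> {a..b}" for s t
    using lip1 [of s t] lip1 [of t s] that
    by (cases s t rule: linorder_cases) (auto simp: abs_minus_commute)
  \<comment> \<open>Up to \<open>(t - mid) * f mid\<close>, which integrates to 0, \<open>E t\<close> is the difference between the trapezoidal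
    value and \<open>t * f t\<close>. Including this term makes \<open>E\<close> small pointwise.\<close>
  define E where "E t = mid * ((f a + f b) / 2 - f t) - (t - mid) * (f t - f mid)" for t
  have E_le: "\<bar>E t\<bar> \<le> B" if t: "t \<in> {a..b}" for t
  proof -
    have "\<bar>f a - f t\<bar> \<le> K * (t - a)" "\<bar>f b - f t\<bar> \<le> K * (b - t)"
      using lip [of t a] lip [of t b] t \<open>d > 0\<close> by (auto simp: b_def)
    then have "\<bar>(f a + f b) / 2 - f t\<bar> \<le> (K * (t - a) + K * (b - t)) / 2"
      by (simp add: abs_le_iff field_simps)
    also have "\<dots> = K * (d / 2)" by (simp add: b_def algebra_simps)
    finally have "\<bar>mid * ((f a + f b) / 2 - f t)\<bar> \<le> mid * (K * (d / 2))"
      unfolding abs_mult using mid by (intro mult_mono) auto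
    moreover have "\<bar>(t - mid) * (f t - f mid)\<bar> \<le> (d / 2) * (K * (d / 2))"
    proof -
      have "\<bar>t - mid\<bar> \<le> d / 2" using t unfolding atLeastAtMost_iff mid_def b_def by linarith
      moreover have "\<bar>f t - f mid\<bar> \<le> K * \<bar>t - mid\<bar>"
        using t \<open>d > 0\<close> by (intro lip) (auto simp: mid_def b_def)
      moreover have "K * \<bar>t - mid\<bar> \<le> K * (d / 2)"
        using calculation(1) K by (intro mult_left_mono) auto
      ultimately show ?thesis unfolding abs_mult using \<open>d > 0\<close> by (intro mult_mono) auto
    qed
    ultimately have "\<bar>E t\<bar> \<le> mid * (K * (d / 2)) + (d / 2) * (K * (d / 2))"
      unfolding E_def by linarith
    also have "\<dots> = B" by (simp add: B_def algebra_simps power2_eq_square)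
    finally show ?thesis .
  qed
  have ab: "a \<le> b" using \<open>d > 0\<close> by (simp add: b_def)
  have i1: "((\<lambda>t. t * f t + h t - c) has_integral f b - f a) {a..b}"
    using f' f ab by (intro fundamental_theorem_of_calculus_interior)
      (auto simp: b_def has_real_derivative_iff_has_vector_derivative)
  have i2: "(h has_integral integral {a..b} h) {a..b}"
    by (intro integrable_integral integrable_continuous_interval continuous_on_subset [OF h]) auto
  have i3: "((\<lambda>t. mid * ((f a + f b) / 2) - mid * f mid - c) has_integral
      (b - a) *\<^sub>R (mid * ((f a + f b) / 2) - mid * f mid - c)) {a..b}"
    using has_integral_const_real [of "mid * ((f a + f b) / 2) - mid * f mid - c" a b] ab by simp
  have i4: "((\<lambda>t. t * f mid) has_integral ((b\<^sup>2 - a\<^sup>2) / 2) * f mid) {a..b}"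
    by (intro has_integral_mult_left ident_has_integral ab)
  have "((\<lambda>t. (mid * ((f a + f b) / 2) - mid * f mid - c) + t * f mid + h t - (t * f t + h t - c))
      has_integral ((b - a) *\<^sub>R (mid * ((f a + f b) / 2) - mid * f mid - c)
        + ((b\<^sup>2 - a\<^sup>2) / 2) * f mid + integral {a..b} h - (f b - f a))) {a..b}"
    by (intro has_integral_add has_integral_diff i1 i2 i3 i4)
  also have "(\<lambda>t. (mid * ((f a + f b) / 2) - mid * f mid - c) + t * f mid + h t - (t * f t + h t - c)) = E"
    by (rule ext) (simp add: E_def algebra_simps)
  also have "(b - a) *\<^sub>R (mid * ((f a + f b) / 2) - mid * f mid - c)
        + ((b\<^sup>2 - a\<^sup>2) / 2) * f mid + integral {a..b} h - (f b - f a)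
      = d * (integral {a..b} h / d - c - ((f b - f a) / d - mid * ((f a + f b) / 2)))"
  proof -
    have "(b\<^sup>2 - a\<^sup>2) / 2 = d * mid" by (simp add: b_def mid_def power2_eq_square algebra_simps)
    then show ?thesis using \<open>d > 0\<close> by (simp add: b_def field_simps)
  qed
  finally have "norm (d * (integral {a..b} h / d - c - ((f b - f a) / d - mid * ((f a + f b) / 2))))
      \<le> B * measure lborel {a..b}"
    using E_le mid by (intro has_integral_bound_real [of B "{}" E]) auto
  then have "d * \<bar>integral {a..b} h / d - c - ((f b - f a) / d - mid * ((f a + f b) / 2))\<bar> \<le> d * B"
    using \<open>d > 0\<close> by (simp add: abs_mult b_def mult.commute)
  then show ?thesis using \<open>d > 0\<close> unfolding B_def b_def mid_def by simp
qed

section \<open>The Stein identity for the number of sign changes\<close>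

text \<open>By the ratio of consecutive probabilities the summands telescope. The boundary terms vanish because
\<open>m + 1\<close> sign changes have probability 0 and \<open>g 0 = 0\<close>.\<close>
lemma discrete_stein_identity:
  fixes g :: "nat \<Rightarrow> real"
  assumes "g 0 = 0"
  shows "(\<Sum>c\<le>m. sign_change_prob m c *
     ((2 * real m + 1) * (g (Suc c) - g c) - (2 * real c + 1) * (g (Suc c) + g c))) = 0"
proof -
  define T where "T c = 2 * (real m + 1 + real c) * sign_change_prob m c * g c" for c
  have "sign_change_prob m c *
     ((2 * real m + 1) * (g (Suc c) - g c) - (2 * real c + 1) * (g (Suc c) + g c))
    = T (Suc c) - T c" for c
  proof -
    have "T (Suc c) = 2 * ((real m + 2 + real c) * sign_change_prob m (Suc c)) * g (Suc c)"
      by (simp add: T_def algebra_simps)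
    then show ?thesis unfolding sign_change_prob_Suc by (simp add: T_def algebra_simps)
  qed
  then have "(\<Sum>c\<le>m. sign_change_prob m c *
     ((2 * real m + 1) * (g (Suc c) - g c) - (2 * real c + 1) * (g (Suc c) + g c)))
    = (\<Sum>c<Suc m. T (Suc c) - T c)" by (simp add: lessThan_Suc_atMost)
  also have "\<dots> = T (Suc m) - T 0" by (rule sum_lessThan_telescope)
  also have "\<dots> = 0" by (simp add: T_def assms sign_change_prob_eq_0)
  finally show ?thesis .
qed

text \<open>Since \<open>2 * C + 1\<close> is distributed like the distance from 0 at time \<open>2 * m + 1\<close>, its second moment is
\<open>2 * m + 1\<close>; in terms of the Stein identity this is the case \<open>g c = c\<close>. The first moment is then bounded
by means of \<open>2 * s * x \<le> s\<^sup>2 + x\<^sup>2\<close>.\<close>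
lemma mean_odd_displacement_le:
  "(\<Sum>c\<le>m. sign_change_prob m c * (2 * real c + 1)) \<le> sqrt (2 * real m + 1)"
proof -
  define s where "s = sqrt (2 * real m + 1)"
  have s: "s > 0" "s * s = 2 * real m + 1" by (simp_all add: s_def)
  have "(\<Sum>c\<le>m. sign_change_prob m c * ((2 * real m + 1) - (2 * real c + 1)\<^sup>2)) = 0"
    using discrete_stein_identity [of real m] by (simp add: power2_eq_square algebra_simps)
  then have sq: "(\<Sum>c\<le>m. sign_change_prob m c * (2 * real c + 1)\<^sup>2) = s * s"
    unfolding right_diff_distrib sum_subtractf s(2)
    by (simp add: sum_distrib_right [symmetric] sum_sign_change_prob)
  have "2 * s * (\<Sum>c\<le>m. sign_change_prob m c * (2 * real c + 1))
    = (\<Sum>c\<le>m. sign_change_prob m c * (2 * s * (2 * real c + 1)))"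
    by (simp add: sum_distrib_left mult_ac)
  also have "\<dots> \<le> (\<Sum>c\<le>m. sign_change_prob m c * (s * s + (2 * real c + 1)\<^sup>2))"
  proof (intro sum_mono mult_left_mono sign_change_prob_nonneg)
    fix c show "2 * s * (2 * real c + 1) \<le> s * s + (2 * real c + 1)\<^sup>2"
      using zero_le_power2 [of "s - (2 * real c + 1)"] by (simp add: power2_eq_square algebra_simps)
  qed
  also have "\<dots> = 2 * s * s"
    unfolding distrib_left sum.distrib sq
    by (simp add: sum_distrib_right [symmetric] sum_sign_change_prob)
  finally show ?thesis using s(1) unfolding s_def [symmetric] by simp
qed

text \<open>For \<open>f\<close> the Stein solution and \<open>g c = f (d * c)\<close>, the discrete Stein identity says exactly that the
difference quotients of \<open>f\<close> on the cells \<open>[d * c, d * c + d]\<close> and the trapezoidal approximations of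
\<open>t * f t\<close> have the same mean. So only the trapezoidal errors remain. The test function
appears averaged over the cells: \<open>d * C\<close> is compared with the half-normal law after adding an
independent uniform variable on \<open>[0, d]\<close>.\<close>
lemma smoothed_expectation_bound:
  fixes h :: "real \<Rightarrow> real" and m :: nat
  defines "d \<equiv> 2 / sqrt (2 * real m + 1)"
  assumes h: "continuous_on UNIV h"
    and bd: "\<And>t. t > 0 \<Longrightarrow> \<bar>t * stein_solution h \<mu> t + h t - \<mu>\<bar> \<le> 2"
  shows "\<bar>(\<Sum>c\<le>m. sign_change_prob m c * (integral {d * real c..d * real c + d} h / d)) - \<mu>\<bar>
     \<le> d + d\<^sup>2 / 2"
proof -
  let ?p = "sign_change_prob m"
  let ?f = "stein_solution h \<mu>"
  define s where "s = sqrt (2 * real m + 1)"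
  have s: "s > 0" "s * s = 2 * real m + 1" and d: "d = 2 / s" "d > 0"
    by (simp_all add: s_def d_def add_pos_nonneg)
  define A where "A c = integral {d * real c..d * real c + d} h / d" for c
  define S where "S c = (?f (d * real c + d) - ?f (d * real c)) / d
     - (d * real c + d / 2) * ((?f (d * real c) + ?f (d * real c + d)) / 2)" for c
  have "(\<Sum>c\<le>m. ?p c * S c) = (\<Sum>c\<le>m. ?p c * ((2 * real m + 1) * (?f (d * Suc c) - ?f (d * c))
      - (2 * real c + 1) * (?f (d * Suc c) + ?f (d * c))) * (1 / (2 * s)))"
  proof (intro sum.cong refl)
    fix c
    have e: "d * real (Suc c) = d * real c + d" by (simp add: algebra_simps)
    have "S c = ((2 * real m + 1) * (?f (d * Suc c) - ?f (d * c))
      - (2 * real c + 1) * (?f (d * Suc c) + ?f (d * c))) * (1 / (2 * s))"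
      unfolding e S_def s(2) [symmetric] using s(1) by (simp add: d(1) field_simps)
    then show "?p c * S c = ?p c * ((2 * real m + 1) * (?f (d * Suc c) - ?f (d * c))
      - (2 * real c + 1) * (?f (d * Suc c) + ?f (d * c))) * (1 / (2 * s))" by simp
  qed
  also have "\<dots> = 0"
    unfolding sum_distrib_right [symmetric]
    using discrete_stein_identity [of "\<lambda>c. ?f (d * real c)" m] by simp
  finally have S0: "(\<Sum>c\<le>m. ?p c * S c) = 0" .
  have "(\<Sum>c\<le>m. ?p c * A c) - \<mu> = (\<Sum>c\<le>m. ?p c * (A c - \<mu> - S c))"
    unfolding right_diff_distrib sum_subtractf S0
    by (simp add: sum_distrib_right [symmetric] sum_sign_change_prob)
  also have "\<bar>\<dots>\<bar> \<le> (\<Sum>c\<le>m. \<bar>?p c * (A c - \<mu> - S c)\<bar>)" by (rule sum_abs)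
  also have "\<dots> \<le> (\<Sum>c\<le>m. ?p c * (2 * ((d * real c + d / 2) * (d / 2) + d\<^sup>2 / 4)))"
  proof (intro sum_mono)
    fix c
    have pos: "d * real c \<ge> 0" using d(2) by simp
    have "\<bar>A c - \<mu> - S c\<bar> \<le> 2 * ((d * real c + d / 2) * (d / 2) + d\<^sup>2 / 4)"
      unfolding A_def S_def
    proof (rule trapezoid_step [OF h d(2) pos])
      fix t assume "d * real c < t"
      then have t: "t > 0" using pos by simp
      show "(?f has_real_derivative t * ?f t + h t - \<mu>) (at t)"
        by (rule stein_solution_deriv [OF h t])
      show "\<bar>t * ?f t + h t - \<mu>\<bar> \<le> 2" by (rule bd [OF t])
    qed (use stein_solution_continuous [OF h pos] in auto)
    then show "\<bar>?p c * (A c - \<mu> - S c)\<bar> \<le> ?p c * (2 * ((d * real c + d / 2) * (d / 2) + d\<^sup>2 / 4))"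
      unfolding abs_mult using sign_change_prob_nonneg [of m c] by (simp add: mult_left_mono)
  qed
  also have "\<dots> = (\<Sum>c\<le>m. ?p c * (2 * real c + 1) * (d\<^sup>2 / 2) + ?p c * (d\<^sup>2 / 2))"
    by (intro sum.cong refl) (simp add: power2_eq_square field_simps)
  also have "\<dots> = (\<Sum>c\<le>m. ?p c * (2 * real c + 1)) * (d\<^sup>2 / 2) + d\<^sup>2 / 2"
    unfolding sum.distrib sum_distrib_right [symmetric] sum_sign_change_prob by simp
  also have "\<dots> \<le> s * (d\<^sup>2 / 2) + d\<^sup>2 / 2"
    using mean_odd_displacement_le [of m] unfolding s_def [symmetric]
    by (intro add_right_mono mult_right_mono) auto
  also have "s * (d\<^sup>2 / 2) = d" using s(1) by (simp add: d(1) power2_eq_square)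
  finally show ?thesis unfolding A_def .
qed

section \<open>Bounds for the Wasserstein and Kolmogorov distances\<close>

lemma integrable_std_normal_density: "integrable lborel std_normal_density"
  using integrable_std_normal_moment [of 0] by simp

lemma integral_std_normal_density: "(\<integral>z. std_normal_density z \<partial>lborel) = 1"
  using integral_std_normal_moment_even [of 0] by simp

text \<open>The distance of the mean of \<open>h\<close> from \<open>h 0\<close> is at most the first absolute moment \<open>sqrt (2 / pi)\<close> of the
normal distribution.\<close>
lemma lipschitz_half_normal:
  assumes h: "1-lipschitz_on UNIV h"
  shows "integrable lborel (\<lambda>z. std_normal_density z * h \<bar>z\<bar>)"
    and "\<bar>h 0 - (\<integral>z. std_normal_density z * h \<bar>z\<bar> \<partial>lborel)\<bar> \<le> 1"
proof -
  have [measurable]: "h \<in> borel_measurable borel"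
    by (intro borel_measurable_continuous_onI lipschitz_on_continuous_on [OF h])
  have lip: "\<bar>h s - h t\<bar> \<le> \<bar>s - t\<bar>" for s t
    using lipschitz_onD [OF h, of s t] by (simp add: dist_real_def)
  have m1: "integrable lborel (\<lambda>z. std_normal_density z * \<bar>z\<bar>)"
    using integrable_std_normal_moment_abs [of 1] by simp
  have le: "\<bar>std_normal_density z * (h \<bar>z\<bar> - h 0)\<bar> \<le> std_normal_density z * \<bar>z\<bar>" for z
    using lip [of "\<bar>z\<bar>" 0] by (simp add: abs_mult mult_left_mono)
  have i: "integrable lborel (\<lambda>z. std_normal_density z * (h \<bar>z\<bar> - h 0))"
    by (rule Bochner_Integration.integrable_bound [OF m1]) (use le in auto)
  have i0: "integrable lborel (\<lambda>z. std_normal_density z * h 0)"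
    by (intro integrable_mult_left integrable_std_normal_density) 
  have eq: "std_normal_density z * h \<bar>z\<bar> =
      std_normal_density z * (h \<bar>z\<bar> - h 0) + std_normal_density z * h 0" for z
    by (simp add: algebra_simps)
  show "integrable lborel (\<lambda>z. std_normal_density z * h \<bar>z\<bar>)"
    unfolding eq by (intro Bochner_Integration.integrable_add i i0)
  have "(\<integral>z. std_normal_density z * h \<bar>z\<bar> \<partial>lborel) =
      (\<integral>z. std_normal_density z * (h \<bar>z\<bar> - h 0) \<partial>lborel) + h 0"
    unfolding eq using i i0 by (simp add: integral_std_normal_density)
  then have "\<bar>h 0 - (\<integral>z. std_normal_density z * h \<bar>z\<bar> \<partial>lborel)\<bar> =
      \<bar>\<integral>z. std_normal_density z * (h \<bar>z\<bar> - h 0) \<partial>lborel\<bar>" by simp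
  also have "\<dots> \<le> (\<integral>z. std_normal_density z * \<bar>z\<bar> \<partial>lborel)"
    by (rule Bochner_Integration.integral_abs_bound_integral [OF i m1 le])
  also have "\<dots> = sqrt (2 / pi)" using integral_std_normal_moment_abs_odd [of 0] by simp
  also have "\<dots> \<le> 1" using pi_gt3 by simp
  finally show "\<bar>h 0 - (\<integral>z. std_normal_density z * h \<bar>z\<bar> \<partial>lborel)\<bar> \<le> 1" .
qed

text \<open>The half-normal density is at most \<open>sqrt (2 / pi)\<close>.\<close>
lemma half_normal_interval_le:
  assumes "prob_space N" and Z: "distributed N lborel Z std_normal_density" and "u \<le> v"
  shows "measure N {\<omega> \<in> space N. \<bar>Z \<omega>\<bar> \<le> v} \<le>
    measure N {\<omega> \<in> space N. \<bar>Z \<omega>\<bar> \<le> u} + (v - u) * sqrt (2 / pi)"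
proof -
  interpret prob_space N by fact
  have [measurable]: "Z \<in> borel_measurable N" using distributed_measurable [OF Z] by simp
  have le: "prob (Z -` A \<inter> space N) \<le> (v - u) / sqrt (2 * pi)"
    if A: "A \<in> sets borel" "emeasure lborel A = ennreal (v - u)" for A
  proof -
    have "emeasure N (Z -` A \<inter> space N) = (\<integral>\<^sup>+x. ennreal (std_normal_density x) * indicator A x \<partial>lborel)"
      using A by (intro distributed_emeasure [OF Z]) auto
    also have "\<dots> \<le> (\<integral>\<^sup>+x. ennreal (1 / sqrt (2 * pi)) * indicator A x \<partial>lborel)"
      by (intro nn_integral_mono mult_right_mono ennreal_leI)
        (auto simp: std_normal_density_def divide_right_mono)
    also have "\<dots> = ennreal (1 / sqrt (2 * pi)) * emeasure lborel A"
      using A by (subst nn_integral_cmult_indicator) auto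
    also have "\<dots> = ennreal ((v - u) / sqrt (2 * pi))"
      unfolding A(2) using \<open>u \<le> v\<close> by (subst ennreal_mult' [symmetric]) auto
    finally show ?thesis
      using \<open>u \<le> v\<close> by (simp add: emeasure_eq_measure)
  qed
  have "prob {\<omega> \<in> space N. \<bar>Z \<omega>\<bar> \<le> v} \<le> prob ({\<omega> \<in> space N. \<bar>Z \<omega>\<bar> \<le> u} \<union>
     ((Z -` {u<..v} \<inter> space N) \<union> (Z -` {-v..<-u} \<inter> space N)))"
    by (intro finite_measure_mono) auto
  also have "\<dots> \<le> prob {\<omega> \<in> space N. \<bar>Z \<omega>\<bar> \<le> u} +
     (prob (Z -` {u<..v} \<inter> space N) + prob (Z -` {-v..<-u} \<inter> space N))"
    by (rule order_trans [OF measure_Un_le add_left_mono [OF measure_Un_le]]) auto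
  also have "\<dots> \<le> prob {\<omega> \<in> space N. \<bar>Z \<omega>\<bar> \<le> u} +
     ((v - u) / sqrt (2 * pi) + (v - u) / sqrt (2 * pi))"
    using \<open>u \<le> v\<close> by (intro add_left_mono add_mono le) auto
  also have "(v - u) / sqrt (2 * pi) + (v - u) / sqrt (2 * pi) = (v - u) * sqrt (2 / pi)"
  proof -
    have "sqrt (2 * pi) * sqrt (2 / pi) = 2" by (simp add: real_sqrt_mult [symmetric])
    then have "sqrt (2 / pi) = 2 / sqrt (2 * pi)" by (simp add: field_simps)
    moreover have "x / q + x / q = x * (2 / q)" for x q :: real by simp
    ultimately show ?thesis by (simp only:)
  qed
  finally show ?thesis .
qed

lemma distributed_abs_expectation:
  assumes Z: "distributed N lborel Z std_normal_density"
    and h: "continuous_on UNIV h"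
  shows "(\<integral>\<omega>. h \<bar>Z \<omega>\<bar> \<partial>N) = (\<integral>z. std_normal_density z * h \<bar>z\<bar> \<partial>lborel)"
proof -
  have [measurable]: "h \<in> borel_measurable borel"
    by (intro borel_measurable_continuous_onI h)
  show ?thesis by (rule distributed_integral [OF Z, symmetric]) auto
qed

text \<open>Averaging a function with Lipschitz constant 1 over a cell of length \<open>d\<close> changes its value at the left
end by at most \<open>d / 2\<close>; the rest is the smoothed bound.\<close>
lemma wasserstein_test_function_bound:
  fixes h :: "real \<Rightarrow> real" and m :: nat
  defines "d \<equiv> 2 / sqrt (2 * real m + 1)"
  assumes X: "simple_symmetric_steps M X"
    and Z: "distributed N lborel Z std_normal_density"
    and h: "1-lipschitz_on UNIV h"
  shows "\<bar>(\<integral>\<omega>. h (d * real (sign_changes X (2 * m + 1) \<omega>)) \<partial>M) - (\<integral>\<omega>. h \<bar>Z \<omega>\<bar> \<partial>N)\<bar>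
    \<le> 3 / 2 * d + d\<^sup>2 / 2"
proof -
  let ?p = "sign_change_prob m"
  define \<mu> where "\<mu> = (\<integral>z. std_normal_density z * h \<bar>z\<bar> \<partial>lborel)"
  have d: "d > 0" by (simp add: d_def add_pos_nonneg)
  have cont: "continuous_on UNIV h" by (rule lipschitz_on_continuous_on [OF h])
  have lip: "\<bar>h s - h t\<bar> \<le> \<bar>s - t\<bar>" for s t
    using lipschitz_onD [OF h, of s t] by (simp add: dist_real_def)
  have lim: "(gauss_primitive h \<mu> \<longlongrightarrow> 0) at_top"
    by (rule gauss_primitive_tendsto_0 [OF cont lipschitz_half_normal(1) [OF h] \<mu>_def])
  have main: "\<bar>(\<Sum>c\<le>m. ?p c * (integral {d * real c..d * real c + d} h / d)) - \<mu>\<bar> \<le> d + d\<^sup>2 / 2"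
    unfolding d_def
    by (rule smoothed_expectation_bound [OF cont stein_deriv_bound_lipschitz [OF h lim]])
      (use lipschitz_half_normal(2) [OF h] in \<open>auto simp: \<mu>_def\<close>)
  have avg: "\<bar>h a - integral {a..a + d} h / d\<bar> \<le> d / 2" for a
  proof -
    have "((\<lambda>t. t - a) has_integral ((a + d)\<^sup>2 - a\<^sup>2) / 2 - (a + d - a) *\<^sub>R a) {a..a + d}"
      using d has_integral_const_real [of a a "a + d"]
      by (intro has_integral_diff ident_has_integral) auto
    moreover have "((a + d)\<^sup>2 - a\<^sup>2) / 2 - (a + d - a) *\<^sub>R a = d\<^sup>2 / 2"
      by (simp add: power2_eq_square algebra_simps)
    ultimately have lin: "((\<lambda>t. t - a) has_integral d\<^sup>2 / 2) {a..a + d}" by (simp only:)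
    have hi: "h integrable_on {a..a + d}"
      by (intro integrable_continuous_interval continuous_on_subset [OF cont]) auto
    have "norm (integral {a..a + d} (\<lambda>t. h t - h a)) \<le> integral {a..a + d} (\<lambda>t. t - a)"
    proof (rule Henstock_Kurzweil_Integration.integral_norm_bound_integral)
      show "(\<lambda>t. h t - h a) integrable_on {a..a + d}"
        using hi by (intro integrable_diff) auto
      show "(\<lambda>t. t - a) integrable_on {a..a + d}" using lin by blast
      show "norm (h t - h a) \<le> t - a" if "t \<in> {a..a + d}" for t
        using lip [of t a] that by simp
    qed
    also have "integral {a..a + d} (\<lambda>t. h t - h a) = integral {a..a + d} h - d * h a"
      using hi d by (subst Henstock_Kurzweil_Integration.integral_diff) auto
    also have "integral {a..a + d} (\<lambda>t. t - a) = d\<^sup>2 / 2" using lin by (rule integral_unique)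
    finally have "\<bar>integral {a..a + d} h - d * h a\<bar> \<le> d\<^sup>2 / 2" by simp
    moreover have "integral {a..a + d} h - d * h a = - (d * (h a - integral {a..a + d} h / d))"
      using d by (simp add: field_simps)
    ultimately have "d * \<bar>h a - integral {a..a + d} h / d\<bar> \<le> d * (d / 2)"
      using d by (simp add: abs_mult power2_eq_square)
    then show ?thesis using d by simp
  qed
  have "\<bar>(\<Sum>c\<le>m. ?p c * h (d * real c)) - (\<Sum>c\<le>m. ?p c * (integral {d * real c..d * real c + d} h / d))\<bar>
    \<le> (\<Sum>c\<le>m. \<bar>?p c * (h (d * real c) - integral {d * real c..d * real c + d} h / d)\<bar>)"
    unfolding sum_subtractf [symmetric] right_diff_distrib [symmetric] by (rule sum_abs)
  also have "\<dots> \<le> (\<Sum>c\<le>m. ?p c * (d / 2))"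
    unfolding abs_mult using sign_change_prob_nonneg [of m]
    by (intro sum_mono mult_mono avg) auto
  also have "\<dots> = d / 2" unfolding sum_distrib_right [symmetric] sum_sign_change_prob by simp
  finally have "\<bar>(\<Sum>c\<le>m. ?p c * h (d * real c)) - \<mu>\<bar> \<le> 3 / 2 * d + d\<^sup>2 / 2"
    using main by linarith
  then show ?thesis
    unfolding sign_changes_expectation [OF X, of "\<lambda>c. h (d * real c)" m]
      distributed_abs_expectation [OF Z cont] \<mu>_def .
qed

text \<open>A continuous substitute for the indicator of \<open>{..v}\<close>, which keeps the Stein solution differentiable. Its
descent takes place on one cell length \<open>d\<close>, so that smoothing costs no more than the discretisation.\<close>
definition ramp :: "real \<Rightarrow> real \<Rightarrow> real \<Rightarrow> real" where
  "ramp d v t = max 0 (min 1 ((v + d - t) / d))"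

lemma ramp_bounds: "0 \<le> ramp d v t" "ramp d v t \<le> 1"
  by (auto simp: ramp_def)

lemma ramp_eq_1: "d > 0 \<Longrightarrow> t \<le> v \<Longrightarrow> ramp d v t = 1"
  by (simp add: ramp_def)

lemma ramp_eq_0: "d > 0 \<Longrightarrow> t \<ge> v + d \<Longrightarrow> ramp d v t = 0"
  by (simp add: ramp_def divide_nonpos_pos max_absorb1 min.coboundedI2)

lemma continuous_ramp: "d > 0 \<Longrightarrow> continuous_on UNIV (ramp d v)"
  unfolding ramp_def by (intro continuous_intros) auto

lemma smoothed_cdf_bounds:
  fixes m :: nat and v :: real
  defines "d \<equiv> 2 / sqrt (2 * real m + 1)"
  defines "A \<equiv> \<Sum>c\<le>m. sign_change_prob m c * (integral {d * real c..d * real c + d} (ramp d v) / d)"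
  assumes N: "prob_space N" and Z: "distributed N lborel Z std_normal_density"
  shows "A \<le> measure N {\<omega> \<in> space N. \<bar>Z \<omega>\<bar> \<le> v + d} + (d + d\<^sup>2 / 2)"
    and "measure N {\<omega> \<in> space N. \<bar>Z \<omega>\<bar> \<le> v} \<le> A + (d + d\<^sup>2 / 2)"
proof -
  interpret prob_space N by fact
  have [measurable]: "Z \<in> borel_measurable N" using distributed_measurable [OF Z] by simp
  have d: "d > 0" by (simp add: d_def add_pos_nonneg)
  define h where "h = ramp d v"
  have cont: "continuous_on UNIV h" unfolding h_def by (rule continuous_ramp [OF d])
  have [measurable]: "h \<in> borel_measurable borel" by (intro borel_measurable_continuous_onI cont)
  have h01: "0 \<le> h t" "h t \<le> 1" for t by (simp_all add: h_def ramp_bounds)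
  have h1: "h t = 1" if "t \<le> v" for t using that d by (simp add: h_def ramp_eq_1)
  have h2: "h t = 0" if "t \<ge> v + d" for t using that d by (simp add: h_def ramp_eq_0)
  define \<mu> where "\<mu> = (\<integral>z. std_normal_density z * h \<bar>z\<bar> \<partial>lborel)"
  have \<mu>: "\<mu> = expectation (\<lambda>\<omega>. h \<bar>Z \<omega>\<bar>)"
    unfolding \<mu>_def by (rule distributed_abs_expectation [OF Z cont, symmetric])
  have int: "integrable N (\<lambda>\<omega>. h \<bar>Z \<omega>\<bar>)"
    by (rule integrable_const_bound [of _ 1]) (use h01 in auto)
  have int2: "integrable lborel (\<lambda>z. std_normal_density z * h \<bar>z\<bar>)"
    by (rule Bochner_Integration.integrable_bound [OF integrable_std_normal_density])
      (use h01 in \<open>auto simp: abs_mult mult_left_le\<close>)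
  have le: "\<mu> \<le> prob {\<omega> \<in> space N. \<bar>Z \<omega>\<bar> \<le> v + d}"
  proof -
    have "\<mu> \<le> expectation (indicator {\<omega> \<in> space N. \<bar>Z \<omega>\<bar> \<le> v + d})"
      unfolding \<mu>
    proof (rule integral_mono [OF int])
      show "integrable N (indicator {\<omega> \<in> space N. \<bar>Z \<omega>\<bar> \<le> v + d} :: _ \<Rightarrow> real)"
        by (intro integrable_real_indicator) (auto simp: emeasure_eq_measure)
      show "h \<bar>Z \<omega>\<bar> \<le> indicator {\<omega> \<in> space N. \<bar>Z \<omega>\<bar> \<le> v + d} \<omega>" if "\<omega> \<in> space N" for \<omega>
        using that h01(2) h2 [of "\<bar>Z \<omega>\<bar>"] by (auto simp: indicator_def)
    qed
    then show ?thesis by simp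
  qed
  have ge: "prob {\<omega> \<in> space N. \<bar>Z \<omega>\<bar> \<le> v} \<le> \<mu>"
  proof -
    have "expectation (indicator {\<omega> \<in> space N. \<bar>Z \<omega>\<bar> \<le> v}) \<le> \<mu>"
      unfolding \<mu>
    proof (rule integral_mono [OF _ int])
      show "integrable N (indicator {\<omega> \<in> space N. \<bar>Z \<omega>\<bar> \<le> v} :: _ \<Rightarrow> real)"
        by (intro integrable_real_indicator) (auto simp: emeasure_eq_measure)
      show "indicator {\<omega> \<in> space N. \<bar>Z \<omega>\<bar> \<le> v} \<omega> \<le> h \<bar>Z \<omega>\<bar>" if "\<omega> \<in> space N" for \<omega>
        using that h01(1) h1 [of "\<bar>Z \<omega>\<bar>"] by (auto simp: indicator_def)
    qed
    then show ?thesis by simp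
  qed
  have "0 \<le> \<mu>" "\<mu> \<le> 1"
    using ge measure_nonneg [of N "{\<omega> \<in> space N. \<bar>Z \<omega>\<bar> \<le> v}"] le
      prob_le_1 [of "{\<omega> \<in> space N. \<bar>Z \<omega>\<bar> \<le> v + d}"] by linarith+
  then have bd: "\<bar>h t - \<mu>\<bar> \<le> 1" for t using h01 [of t] by (simp add: abs_le_iff)
  have lim: "(gauss_primitive h \<mu> \<longlongrightarrow> 0) at_top"
    by (rule gauss_primitive_tendsto_0 [OF cont int2 \<mu>_def])
  have "\<bar>A - \<mu>\<bar> \<le> d + d\<^sup>2 / 2"
    unfolding A_def h_def [symmetric] unfolding d_def
    by (rule smoothed_expectation_bound [OF cont stein_deriv_bound_bounded [OF cont lim bd]])
  then show "A \<le> prob {\<omega> \<in> space N. \<bar>Z \<omega>\<bar> \<le> v + d} + (d + d\<^sup>2 / 2)"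
    and "prob {\<omega> \<in> space N. \<bar>Z \<omega>\<bar> \<le> v} \<le> A + (d + d\<^sup>2 / 2)"
    using le ge by linarith+
qed

text \<open>The distribution function of the rescaled number of sign changes at \<open>z\<close> is sandwiched between two means of
averaged ramps: \<open>ramp d (z + d)\<close> is 1 on every cell that starts at or below \<open>z\<close>, and \<open>ramp d (z - d)\<close> is 0 on
every cell that starts above \<open>z\<close>. The half-normal distribution function moves by at most \<open>2 * d * sqrt (2 / pi)\<close>
over the resulting shift by \<open>2 * d\<close>.\<close>
lemma kolmogorov_pointwise_bound:
  fixes m :: nat and z :: real
  defines "d \<equiv> 2 / sqrt (2 * real m + 1)"
  assumes X: "simple_symmetric_steps M X"
    and N: "prob_space N" and Z: "distributed N lborel Z std_normal_density"
  shows "\<bar>measure M {\<omega> \<in> space M. d * real (sign_changes X (2 * m + 1) \<omega>) \<le> z}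
     - measure N {\<omega> \<in> space N. \<bar>Z \<omega>\<bar> \<le> z}\<bar> \<le> 2 * d * sqrt (2 / pi) + d + d\<^sup>2 / 2"
proof -
  let ?p = "sign_change_prob m"
  have d: "d > 0" by (simp add: d_def add_pos_nonneg)
  interpret M: prob_space M by (rule simple_symmetric_stepsD [OF X])
  define F where "F = measure M {\<omega> \<in> space M. d * real (sign_changes X (2 * m + 1) \<omega>) \<le> z}"
  define G where "G v = measure N {\<omega> \<in> space N. \<bar>Z \<omega>\<bar> \<le> v}" for v
  define \<phi> :: "nat \<Rightarrow> real" where "\<phi> c = (if d * real c \<le> z then 1 else 0)" for c
  note [measurable] = sign_changes_measurable [OF X]
  have "F = M.expectation (indicator {\<omega> \<in> space M. d * real (sign_changes X (2 * m + 1) \<omega>) \<le> z})"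
    unfolding F_def by simp
  also have "\<dots> = M.expectation (\<lambda>\<omega>. \<phi> (sign_changes X (2 * m + 1) \<omega>))"
    by (intro Bochner_Integration.integral_cong) (auto simp: \<phi>_def indicator_def)
  finally have F: "F = (\<Sum>c\<le>m. ?p c * \<phi> c)" unfolding sign_changes_expectation [OF X] .
  have avg_const: "integral {a..a + d} (\<lambda>_. k) / d = k" for a k :: real using d by simp
  have hi: "h integrable_on {a..b}" if "continuous_on UNIV h" for h :: "real \<Rightarrow> real" and a b
    by (intro integrable_continuous_interval continuous_on_subset [OF that]) auto
  define A where "A v = (\<Sum>c\<le>m. ?p c * (integral {d * real c..d * real c + d} (ramp d v) / d))" for v
  have smooth: "A v \<le> G (v + d) + (d + d\<^sup>2 / 2)" "G v \<le> A v + (d + d\<^sup>2 / 2)" for v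
    unfolding A_def G_def d_def by (rule smoothed_cdf_bounds [OF N Z])+
  have "F \<le> G z + (2 * d * sqrt (2 / pi) + d + d\<^sup>2 / 2)"
  proof -
    have "\<phi> c \<le> integral {d * real c..d * real c + d} (ramp d (z + d)) / d" for c
    proof -
      have "integral {d * real c..d * real c + d} (\<lambda>_. \<phi> c) \<le>
          integral {d * real c..d * real c + d} (ramp d (z + d))"
      proof (rule Henstock_Kurzweil_Integration.integral_le [OF _ hi [OF continuous_ramp [OF d]]])
        show "\<phi> c \<le> ramp d (z + d) t" if "t \<in> {d * real c..d * real c + d}" for t
          using that d ramp_eq_1 [of d t "z + d"] ramp_bounds [of d "z + d" t] by (auto simp: \<phi>_def)
      qed auto
      from divide_right_mono [OF this, of d] show ?thesis using d avg_const by simp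
    qed
    then have "F \<le> A (z + d)"
      unfolding F A_def by (intro sum_mono mult_left_mono sign_change_prob_nonneg)
    moreover have "G (z + d + d) \<le> G z + 2 * d * sqrt (2 / pi)"
      using half_normal_interval_le [OF N Z, of z "z + d + d"] d unfolding G_def by simp
    ultimately show ?thesis using smooth(1) [of "z + d"] by linarith
  qed
  moreover have "G z \<le> F + (2 * d * sqrt (2 / pi) + d + d\<^sup>2 / 2)"
  proof -
    have "integral {d * real c..d * real c + d} (ramp d (z - d)) / d \<le> \<phi> c" for c
    proof -
      have "integral {d * real c..d * real c + d} (ramp d (z - d)) \<le>
          integral {d * real c..d * real c + d} (\<lambda>_. \<phi> c)"
      proof (rule Henstock_Kurzweil_Integration.integral_le [OF hi [OF continuous_ramp [OF d]]])
        show "ramp d (z - d) t \<le> \<phi> c" if "t \<in> {d * real c..d * real c + d}" for t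
          using that d ramp_eq_0 [of d "z - d" t] ramp_bounds [of d "z - d" t] by (auto simp: \<phi>_def)
      qed auto
      from divide_right_mono [OF this, of d] show ?thesis using d avg_const by simp
    qed
    then have "A (z - d) \<le> F"
      unfolding F A_def by (intro sum_mono mult_left_mono sign_change_prob_nonneg)
    moreover have "G z \<le> G (z - d) + d * sqrt (2 / pi)"
      using half_normal_interval_le [OF N Z, of "z - d" z] d unfolding G_def by simp
    moreover have "0 \<le> d * sqrt (2 / pi)" using d by simp
    ultimately show ?thesis using smooth(2) [of "z - d"] by linarith
  qed
  ultimately show ?thesis unfolding F_def G_def by linarith
qed

theorem theorem1p3:
  fixes M :: "'a measure" and X :: "nat \<Rightarrow> 'a \<Rightarrow> real"
    and N :: "'b measure" and Z :: "'b \<Rightarrow> real"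
    and m n :: nat and W :: "'a \<Rightarrow> real" and Y :: "'b \<Rightarrow> real"
  assumes "m \<ge> 1" and "n = 2 * m + 1"
    and "simple_symmetric_steps M X"
    and "W = (\<lambda>\<omega>. 2 * real (sign_changes X n \<omega>) / sqrt (real n))"
    and "prob_space N" and "distributed N lborel Z std_normal_density"
    and "Y = (\<lambda>\<omega>. \<bar>Z \<omega>\<bar>)"
  shows "wasserstein_dist M W N Y \<le>
           ereal (1 / sqrt (real n) * (4 + 2 / pi) + sqrt (2 / pi) * (1 / real n)
             + 2 * sqrt 2 / pi * (1 / real n powr (3 / 2)))
       \<and> kolmogorov_dist M W N Y \<le>
           ereal (1 / sqrt (real n) * ((2 * sqrt 2 + 4) / sqrt pi + 3 / 2) + 3 / real n
             + 4 / sqrt pi * (1 / real n powr (3 / 2)))"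
proof -
  note X = \<open>simple_symmetric_steps M X\<close> and N = \<open>prob_space N\<close>
    and Z = \<open>distributed N lborel Z std_normal_density\<close>
  define s where "s = sqrt (real n)"
  define d where "d = 2 / s"
  have sn: "s = sqrt (2 * real m + 1)" using \<open>n = 2 * m + 1\<close> by (simp add: s_def)
  have s: "s > 0" "s * s = real n" using \<open>n = 2 * m + 1\<close> by (simp_all add: s_def)
  have W: "W \<omega> = d * real (sign_changes X (2 * m + 1) \<omega>)" for \<omega>
    using \<open>n = 2 * m + 1\<close> by (simp add: assms(4) d_def s_def)
  have Y: "Y \<omega> = \<bar>Z \<omega>\<bar>" for \<omega> by (simp add: assms(7))
  have d2: "d\<^sup>2 / 2 = 2 / real n"
    using s by (simp add: d_def power2_eq_square)
  \<comment> \<open>As \<open>sqrt n\<close> is at least \<open>1.7\<close>, the term \<open>2 / n\<close> is absorbed by \<open>(1 + 2 / pi) / sqrt n\<close>.\<close>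
  have w: "3 / 2 * d + d\<^sup>2 / 2 \<le> 1 / s * (4 + 2 / pi) + sqrt (2 / pi) * (1 / real n)
             + 2 * sqrt 2 / pi * (1 / real n powr (3 / 2))"
  proof -
    have "(1.7::real)\<^sup>2 \<le> real n" using \<open>m \<ge> 1\<close> \<open>n = 2 * m + 1\<close> by (simp add: power2_eq_square)
    then have "1.7 \<le> s" unfolding s_def by (rule real_le_rsqrt)
    moreover have "2 / 3.2 \<le> 2 / pi" using pi_less_4 pi_approx by (intro divide_left_mono) auto
    ultimately have "1.7 * 1.6 \<le> s * (1 + 2 / pi)" using s by (intro mult_mono) auto
    then have "2 \<le> s * (1 + 2 / pi)" by (rule order_trans [rotated]) simp
    then have "2 / (s * s) \<le> s * (1 + 2 / pi) / (s * s)" using s by (intro divide_right_mono) auto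
    also have "\<dots> = 1 / s * (1 + 2 / pi)" using s(1) by simp
    finally have "2 / real n \<le> 1 / s * (1 + 2 / pi)" unfolding s(2) .
    moreover have "3 / 2 * d = 1 / s * 3" by (simp add: d_def)
    moreover have "0 \<le> sqrt (2 / pi) * (1 / real n)" "0 \<le> 2 * sqrt 2 / pi * (1 / real n powr (3 / 2))"
      by simp_all
    moreover have "1 / s * (4 + 2 / pi) = 1 / s * 3 + 1 / s * (1 + 2 / pi)"
      unfolding distrib_left [symmetric] by simp
    ultimately show ?thesis unfolding d2 by linarith
  qed
  \<comment> \<open>After multiplication with \<open>sqrt pi\<close> this comes down to \<open>2 * sqrt 2 + sqrt pi / 2 \<le> 4\<close>.\<close>
  have k: "2 * d * sqrt (2 / pi) + d + d\<^sup>2 / 2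
      \<le> 1 / s * ((2 * sqrt 2 + 4) / sqrt pi + 3 / 2) + 3 / real n
             + 4 / sqrt pi * (1 / real n powr (3 / 2))"
  proof -
    have "sqrt 2 \<le> 1.42" by (rule real_le_lsqrt) (auto simp: power2_eq_square)
    moreover have "sqrt pi \<le> 1.8"
      by (rule real_le_lsqrt) (use pi_approx in \<open>auto simp: power2_eq_square\<close>)
    ultimately have "4 * sqrt 2 + sqrt pi / 2 \<le> 2 * sqrt 2 + 4" by simp
    then have "(4 * sqrt 2 + sqrt pi / 2) / sqrt pi \<le> (2 * sqrt 2 + 4) / sqrt pi"
      by (rule divide_right_mono) simp
    then have "4 * sqrt (2 / pi) + 2 \<le> (2 * sqrt 2 + 4) / sqrt pi + 3 / 2"
      by (simp add: add_divide_distrib real_sqrt_divide)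
    then have "1 / s * (4 * sqrt (2 / pi) + 2) \<le> 1 / s * ((2 * sqrt 2 + 4) / sqrt pi + 3 / 2)"
      using s by (intro mult_left_mono) auto
    moreover have "2 * d * sqrt (2 / pi) + d = 1 / s * (4 * sqrt (2 / pi) + 2)"
      using s by (simp add: d_def field_simps)
    moreover have "2 / real n \<le> 3 / real n" by (simp add: divide_right_mono)
    moreover have "0 \<le> 4 / sqrt pi * (1 / real n powr (3 / 2))" by simp
    ultimately show ?thesis unfolding d2 by linarith
  qed
  have "wasserstein_dist M W N Y \<le> ereal (3 / 2 * d + d\<^sup>2 / 2)"
    unfolding wasserstein_dist_def
  proof (rule SUP_least)
    fix h :: "real \<Rightarrow> real" assume "h \<in> {h. 1-lipschitz_on UNIV h}"
    then have h: "1-lipschitz_on UNIV h" by simp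
    show "ereal \<bar>(\<integral>\<omega>. h (W \<omega>) \<partial>M) - (\<integral>\<omega>. h (Y \<omega>) \<partial>N)\<bar> \<le> ereal (3 / 2 * d + d\<^sup>2 / 2)"
      unfolding W Y d_def sn using wasserstein_test_function_bound [OF X Z h] by simp
  qed
  moreover have "kolmogorov_dist M W N Y \<le> ereal (2 * d * sqrt (2 / pi) + d + d\<^sup>2 / 2)"
    unfolding kolmogorov_dist_def
  proof (rule SUP_least)
    fix z :: real
    show "ereal \<bar>measure M {\<omega> \<in> space M. W \<omega> \<le> z} - measure N {\<omega> \<in> space N. Y \<omega> \<le> z}\<bar>
        \<le> ereal (2 * d * sqrt (2 / pi) + d + d\<^sup>2 / 2)"
      unfolding W Y d_def sn using kolmogorov_pointwise_bound [OF X N Z, of m z] by simp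
  qed
  ultimately show ?thesis using w k unfolding s_def
    by (meson ereal_less_eq(3) order_trans)
qed

end
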